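(* Let $\nu>0$, $T>0$, $N$ a positive integer, $\Delta t=T/N$, $t_n=n\Delta t$, $f^n=f(t_n)\in L^2(\Omega)$, and $1\le n\le N$. Given $u_h^{n-1}\in V_h$, the linearized backward Euler HDG scheme: find $(\boldsymbol q_h^n,u_h^n,\widehat u_h^n)\in\boldsymbol Q_h\times V_h\times\widehat V_h$ such that $$\boldsymbol q_h^n+\mathcal K_h(u_h^n,\widehat u_h^n)=0,$$ $$\Big(\frac{u_h^n-u_h^{n-1}}{\Delta t},w\Big)_{\mathcal T_h}+\nu(\mathcal K_h(u_h^n,\widehat u_h^n),\mathcal K_h(w,\mu))_{\mathcal T_h}+\mathcal S_h(u_h^n,\widehat u_h^n;w,\mu)+\mathcal B_h(u_h^{n-1};u_h^n,\widehat u_h^n;w,\mu)=(f^n,w)_{\mathcal T_h}$$ for all $(w,\mu)\in V_h\times\widehat V_h$, admits a unique solution $(\boldsymbol q_h^n,u_h^n,\widehat u_h^n)$.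
   Context: $\Omega\subset\mathbb R^d$ ($d=2,3$) is a polyhedral domain. $\mathcal T_h=\{K\}$ is a partition of $\Omega$ into open polygons/polyhedra; $h_K$ is the infimum of the diameters of circles (spheres) containing $K$, $h=\max_K h_K$. The partition is shape-regular: there are constants $\theta_*,l_*>0$ such that each $K$ is star-shaped with respect to every point of some circle (sphere) centered at a point of $K$ with radius $\theta_*h_K$, and the distance between any two vertices of $K$ is at least $l_*h_K$. $\varepsilon_h$ is the set of all edges/faces and $\varepsilon_h^\partial$ the set of those on $\partial\Omega$; $\boldsymbol n$ is the unit outward normal to $\partial K$. Inner products: $(u,v)_{\mathcal T_h}=\sum_K\int_K uv$, $\langle u,v\rangle_{\partial\mathcal T_h}=\sum_K\int_{\partial K}uv$ (componentwise for vectors). For integers $k\ge1$, $l\in\{k-1,k\}$: $\boldsymbol Q_h=\{\boldsymbol v\in[L^2(\Omega)]^d:\boldsymbol v|_K\in[P_{k-1}(K)]^d\ \forall K\}$, $V_h=\{v\in L^2(\Omega):v|_K\in P_k(K)\ \forall K\}$, $\widehat V_h=\{\widehat v\in L^2(\varepsilon_h):\widehat v|_E\in P_l(E)\ \forall E\in\varepsilon_h,\ \widehat v|_{\varepsilon_h^\partial}=0\}$, where $P_m(D)$ denotes polynomials of degree at most $m$ on $D$. $\Pi_l^\partial$ is the facewise $L^2$ projection onto polynomials of degree $\le l$ (applied on each $\partial K$ to traces from $K$). In the full scheme the starting value is $u_h^0=\Pi_k^ou_0$, with $\Pi_k^o$ the elementwise $L^2$ projection onto $V_h$. $\mathcal K_h:V_h\times\widehat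 V_h\to\boldsymbol Q_h$ is defined by $(\mathcal K_h(w,\mu),\boldsymbol r)_{\mathcal T_h}=-(w,\nabla_h\cdot\boldsymbol r)_{\mathcal T_h}+\langle\mu,\boldsymbol r\cdot\boldsymbol n\rangle_{\partial\mathcal T_h}$ for all $\boldsymbol r\in\boldsymbol Q_h$ ($\nabla_h\cdot$ the elementwise divergence). $\mathcal S_h(u_h,\widehat u_h;w,\mu)=\nu\langle\tau(\Pi_l^\partial u_h-\widehat u_h),\Pi_l^\partial w-\mu\rangle_{\partial\mathcal T_h}$ with $\tau|_{\partial K}=h_K^{-1}$. $\boldsymbol b(v)=[v,\dots,v]^T\in\mathbb R^d$, and $\mathcal B_h(v_h;u_h,\widehat u_h;w,\mu)=-\frac13(\boldsymbol b(v_h)u_h,\nabla w)_{\mathcal T_h}+\frac13(\boldsymbol b(v_h)\cdot\nabla u_h,w)_{\mathcal T_h}-\frac13\langle\boldsymbol b(v_h)\cdot\boldsymbol n\,u_h,\mu\rangle_{\partial\mathcal T_h}+\frac13\langle\boldsymbol b(v_h)\cdot\boldsymbol n\,\widehat u_h,w\rangle_{\partial\mathcal T_h}$ (gradients elementwise). *)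

theory Defs
  imports "HOL-Analysis.Analysis"
begin

text \<open>Possibly non-convex, relatively open polyhedral sets of any dimension. They serve as the
  domain and the mesh cells (where they are open) and as the mesh faces (where they have
  codimension one). Regularity \<open>S = rel_interior (closure S)\<close> excludes slits.\<close>

definition polyhedral :: "'a::euclidean_space set \<Rightarrow> bool" where
  "polyhedral S \<longleftrightarrow> S \<noteq> {} \<and> connected S \<and> S = rel_interior (closure S) \<and>
     (\<exists>\<P>. finite \<P> \<and> (\<forall>P\<in>\<P>. polytope P) \<and> closure S = \<Union>\<P>)"

definition faces_of :: "'a::euclidean_space set set \<Rightarrow> 'a set \<Rightarrow> 'a set set" where
  "faces_of \<E> K = {E\<in>\<E>. E \<subseteq> frontier K}"

text \<open>A mesh consists of its cells \<open>\<T>\<close> and its relatively open edges (in the plane) or faces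
  (in space) \<open>\<E>\<close>. Faces meeting at an angle of 180 degrees are permitted, so that a
  hanging node of a neighbouring cell is treated as an ordinary vertex.\<close>

definition polytopal_mesh ::
    "'a::euclidean_space set \<Rightarrow> 'a set set \<Rightarrow> 'a set set \<Rightarrow> bool" where
  "polytopal_mesh \<Omega> \<T> \<E> \<longleftrightarrow>
     finite \<T> \<and> pairwise disjnt \<T> \<and>
     (\<forall>K\<in>\<T>. open K \<and> polyhedral K \<and> K \<subseteq> \<Omega>) \<and>
     closure \<Omega> = (\<Union>K\<in>\<T>. closure K) \<and>
     finite \<E> \<and> pairwise disjnt \<E> \<and>
     (\<forall>E\<in>\<E>. polyhedral E \<and> aff_dim E = int DIM('a) - 1) \<and>
     (\<forall>E\<in>\<E>. \<exists>K\<in>\<T>. E \<subseteq> frontier K) \<and>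
     (\<forall>E\<in>\<E>. \<forall>K\<in>\<T>. E \<subseteq> frontier K \<or> disjnt E (frontier K)) \<and>
     (\<forall>K\<in>\<T>. frontier K = (\<Union>E\<in>faces_of \<E> K. closure E))"

definition boundary_faces :: "'a::euclidean_space set \<Rightarrow> 'a set set \<Rightarrow> 'a set set" where
  "boundary_faces \<Omega> \<E> = {E\<in>\<E>. E \<subseteq> frontier \<Omega>}"

definition mesh_size :: "'a::euclidean_space set \<Rightarrow> real" where
  "mesh_size K = Inf {2 * r | r. \<exists>c. K \<subseteq> cball c r}"

text \<open>A boundary point is a vertex iff there is no direction along which all faces of the cell
  are translation invariant near that point. (Points inside a face, or inside an
  edge of a three-dimensional cell, do have such a direction.)\<close>

definition vertices_of :: "'a::euclidean_space set set \<Rightarrow> 'a set \<Rightarrow> 'a set" where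
  "vertices_of \<E> K = {x \<in> frontier K.
     \<not> (\<exists>v \<delta>. v \<noteq> 0 \<and> \<delta> > 0 \<and>
         (\<forall>E\<in>faces_of \<E> K. \<forall>y\<in>ball x \<delta>. \<forall>t::real. y + t *\<^sub>R v \<in> ball x \<delta> \<longrightarrow>
            (y \<in> E \<longleftrightarrow> y + t *\<^sub>R v \<in> E)))}"

definition shape_regular ::
    "real \<Rightarrow> real \<Rightarrow> 'a::euclidean_space set set \<Rightarrow> 'a set set \<Rightarrow> bool" where
  "shape_regular \<theta> l\<^sub>s \<T> \<E> \<longleftrightarrow>
     (\<forall>K\<in>\<T>. \<exists>c\<in>K. \<forall>y\<in>ball c (\<theta> * mesh_size K). \<forall>z\<in>K. closed_segment y z \<subseteq> K) \<and>
     (\<forall>K\<in>\<T>. \<forall>x\<in>vertices_of \<E> K. \<forall>y\<in>vertices_of \<E> K.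
        x \<noteq> y \<longrightarrow> l\<^sub>s * mesh_size K \<le> dist x y)"

definition outward_normal :: "'a::euclidean_space set \<Rightarrow> 'a set \<Rightarrow> 'a" where
  "outward_normal K E = (THE n. norm n = 1 \<and> (\<forall>x\<in>E. \<forall>y\<in>E. n \<bullet> (x - y) = 0) \<and>
     (\<forall>x\<in>E. \<exists>\<delta>>0. \<forall>t. 0 < t \<and> t < \<delta> \<longrightarrow> x - t *\<^sub>R n \<in> K \<and> x + t *\<^sub>R n \<notin> K))"

text \<open>Surface measure on a flat face: the area of a subset is the volume of the right prism of
  height one over it. (The choice of the sign of the normal is irrelevant.)\<close>

definition unit_normal :: "'a::euclidean_space set \<Rightarrow> 'a" where
  "unit_normal E = (SOME n. norm n = 1 \<and> (\<forall>x\<in>E. \<forall>y\<in>E. n \<bullet> (x - y) = 0))"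

definition surface_measure :: "'a::euclidean_space set \<Rightarrow> 'a measure" where
  "surface_measure E =
     (let n = unit_normal E; a = (SOME a. a \<in> E) in
      distr (lebesgue_on {x + t *\<^sub>R n | x t. x \<in> E \<and> 0 \<le> t \<and> t \<le> 1})
            (restrict_space borel E) (\<lambda>y. y - ((y - a) \<bullet> n) *\<^sub>R n))"

definition L2 :: "'a measure \<Rightarrow> ('a \<Rightarrow> 'b::{real_normed_vector, second_countable_topology}) set" where
  "L2 M = {f \<in> borel_measurable M. integrable M (\<lambda>x. (norm (f x))\<^sup>2)}"

definition poly_space :: "nat \<Rightarrow> (real^'d \<Rightarrow> real) set" where
  "poly_space m =
     range (\<lambda>(c :: ('d \<Rightarrow> nat) \<Rightarrow> real) x.
       \<Sum>\<alpha> | (\<Sum>i\<in>UNIV. \<alpha> i) \<le> m. c \<alpha> * (\<Prod>i\<in>UNIV. (x $ i) ^ \<alpha> i))"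

text \<open>Functions on a set \<open>D\<close> are represented by functions on the whole space that vanish
  outside \<open>D\<close>.\<close>

definition zero_ext :: "'a set \<Rightarrow> ('a \<Rightarrow> 'b::zero) \<Rightarrow> 'a \<Rightarrow> 'b" where
  "zero_ext D f = (\<lambda>x. if x \<in> D then f x else 0)"

definition poly_on :: "nat \<Rightarrow> (real^'d) set \<Rightarrow> (real^'d \<Rightarrow> real) set" where
  "poly_on m D = zero_ext D ` poly_space m"

text \<open>Each \<open>L\<^sup>2\<close> class in the spaces below is represented by its unique member that is a
  polynomial at every point of each (open) cell or (relatively open) face and that vanishes
  outside the union of these, so that equality of classes is equality of functions.\<close>

definition Q_space :: "nat \<Rightarrow> (real^'d) set \<Rightarrow> (real^'d) set set \<Rightarrow> (real^'d \<Rightarrow> real^'d) set" where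
  "Q_space k \<Omega> \<T> = {q \<in> L2 (lebesgue_on \<Omega>).
     (\<forall>K\<in>\<T>. \<forall>i. zero_ext K (\<lambda>x. q x $ i) \<in> poly_on (k - 1) K) \<and> zero_ext (\<Union>\<T>) q = q}"

definition V_space :: "nat \<Rightarrow> (real^'d) set \<Rightarrow> (real^'d) set set \<Rightarrow> (real^'d \<Rightarrow> real) set" where
  "V_space k \<Omega> \<T> = {v \<in> L2 (lebesgue_on \<Omega>).
     (\<forall>K\<in>\<T>. zero_ext K v \<in> poly_on k K) \<and> zero_ext (\<Union>\<T>) v = v}"

definition Vhat_space ::
    "nat \<Rightarrow> (real^'d) set \<Rightarrow> (real^'d) set set \<Rightarrow> (real^'d \<Rightarrow> real) set" where
  "Vhat_space l \<Omega> \<E> = {\<mu>. (\<forall>E\<in>\<E>. \<mu> \<in> L2 (surface_measure E)) \<and>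
     (\<forall>E\<in>\<E>. zero_ext E \<mu> \<in> poly_on l E) \<and>
     (\<forall>E\<in>boundary_faces \<Omega> \<E>. \<forall>x\<in>E. \<mu> x = 0) \<and> zero_ext (\<Union>\<E>) \<mu> = \<mu>}"

definition trace_from :: "'a::euclidean_space set \<Rightarrow> ('a \<Rightarrow> 'b::t2_space) \<Rightarrow> 'a \<Rightarrow> 'b" where
  "trace_from K v x = Lim (at x within K) v"

definition face_proj :: "nat \<Rightarrow> (real^'d) set \<Rightarrow> (real^'d \<Rightarrow> real) \<Rightarrow> real^'d \<Rightarrow> real" where
  "face_proj l E g = (THE p. p \<in> poly_on l E \<and>
     (\<forall>q\<in>poly_on l E. (\<integral>x. p x * q x \<partial>surface_measure E) = (\<integral>x. g x * q x \<partial>surface_measure E)))"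

definition gradient :: "(real^'d \<Rightarrow> real) \<Rightarrow> real^'d \<Rightarrow> real^'d" where
  "gradient u x = (\<chi> i. frechet_derivative u (at x) (axis i 1))"

definition divergence :: "(real^'d \<Rightarrow> real^'d) \<Rightarrow> real^'d \<Rightarrow> real" where
  "divergence r x = (\<Sum>i\<in>UNIV. frechet_derivative r (at x) (axis i 1) $ i)"

definition cell_inner ::
    "'a::euclidean_space set set \<Rightarrow> ('a \<Rightarrow> 'b::real_inner) \<Rightarrow> ('a \<Rightarrow> 'b) \<Rightarrow> real" where
  "cell_inner \<T> u v = (\<Sum>K\<in>\<T>. \<integral>x. u x \<bullet> v x \<partial>lebesgue_on K)"

text \<open>Quantities on the boundaries of the cells may depend on the cell \<open>K\<close> from which the face
  \<open>E\<close> is seen; hence interior faces contribute once from either side.\<close>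

definition bdry_inner ::
    "'a::euclidean_space set set \<Rightarrow> 'a set set \<Rightarrow>
     ('a set \<Rightarrow> 'a set \<Rightarrow> 'a \<Rightarrow> real) \<Rightarrow> ('a set \<Rightarrow> 'a set \<Rightarrow> 'a \<Rightarrow> real) \<Rightarrow> real" where
  "bdry_inner \<T> \<E> \<phi> \<psi> =
     (\<Sum>K\<in>\<T>. \<Sum>E\<in>faces_of \<E> K. \<integral>x. \<phi> K E x * \<psi> K E x \<partial>surface_measure E)"

definition K_op ::
    "nat \<Rightarrow> (real^'d) set \<Rightarrow> (real^'d) set set \<Rightarrow> (real^'d) set set \<Rightarrow>
     (real^'d \<Rightarrow> real) \<Rightarrow> (real^'d \<Rightarrow> real) \<Rightarrow> real^'d \<Rightarrow> real^'d" where
  "K_op k \<Omega> \<T> \<E> w \<mu> = (THE q. q \<in> Q_space k \<Omega> \<T> \<and>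
     (\<forall>r\<in>Q_space k \<Omega> \<T>.
        cell_inner \<T> q r =
          - cell_inner \<T> w (divergence r)
          + bdry_inner \<T> \<E> (\<lambda>K E. \<mu>) (\<lambda>K E x. trace_from K r x \<bullet> outward_normal K E)))"

definition S_form ::
    "real \<Rightarrow> nat \<Rightarrow> (real^'d) set set \<Rightarrow> (real^'d) set set \<Rightarrow>
     (real^'d \<Rightarrow> real) \<Rightarrow> (real^'d \<Rightarrow> real) \<Rightarrow> (real^'d \<Rightarrow> real) \<Rightarrow> (real^'d \<Rightarrow> real) \<Rightarrow> real" where
  "S_form \<nu> l \<T> \<E> u uh w \<mu> =
     \<nu> * bdry_inner \<T> \<E>
       (\<lambda>K E x. inverse (mesh_size K) * (face_proj l E (trace_from K u) x - uh x))
       (\<lambda>K E x. face_proj l E (trace_from K w) x - \<mu> x)"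

definition b_vec :: "real \<Rightarrow> real^'d" where
  "b_vec v = (\<chi> i. v)"

definition B_form ::
    "(real^'d) set set \<Rightarrow> (real^'d) set set \<Rightarrow> (real^'d \<Rightarrow> real) \<Rightarrow>
     (real^'d \<Rightarrow> real) \<Rightarrow> (real^'d \<Rightarrow> real) \<Rightarrow> (real^'d \<Rightarrow> real) \<Rightarrow> (real^'d \<Rightarrow> real) \<Rightarrow> real" where
  "B_form \<T> \<E> v u uh w \<mu> =
     - (1/3) * cell_inner \<T> (\<lambda>x. u x *\<^sub>R b_vec (v x)) (gradient w)
     + (1/3) * cell_inner \<T> (\<lambda>x. b_vec (v x) \<bullet> gradient u x) w
     - (1/3) * bdry_inner \<T> \<E>
         (\<lambda>K E x. (b_vec (trace_from K v x) \<bullet> outward_normal K E) * trace_from K u x) (\<lambda>K E. \<mu>)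
     + (1/3) * bdry_inner \<T> \<E>
         (\<lambda>K E x. (b_vec (trace_from K v x) \<bullet> outward_normal K E) * uh x) (\<lambda>K E. trace_from K w)"

end

theory Submission
  imports Defs "HOL-Library.Function_Algebras"
begin

text \<open>Eliminating the flux through \<open>q = - K_op u uh\<close> turns a step of the scheme into one linear
  equation for the pair \<open>(u, uh)\<close>: a bilinear form on the finite-dimensional space
  \<open>V_space \<times> Vhat_space\<close> is prescribed on all test pairs. Such an equation has exactly one solution
  as soon as the form is positive on the diagonal away from zero
  (\<open>galerkin_unique_solution\<close>).

  Positivity is the energy identity. When the pair is tested with itself, the convective form
  vanishes, since its two volume terms and its two boundary terms each occur once with either sign
  (\<open>B_form_skew\<close>). What remains is the sum of the mass term \<open>\<parallel>u\<parallel>\<^sup>2 / \<Delta>t\<close>, \<open>\<nu>\<close> times the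
  squared norm of the discrete gradient, and \<open>\<nu>\<close> times the squared norm of \<open>face_proj u - uh\<close>
  weighted by the positive numbers \<open>1 / mesh_size K\<close>. If the sum is zero, then the mass term gives \<open>u = 0\<close>, and the
  penalty, which then is the norm of \<open>uh\<close>, gives \<open>uh = 0\<close> on every face, because every face
  belongs to some cell (\<open>S_form_definite\<close>, \<open>scheme_form_pos\<close>).

  The rest of the work is to see that the form is a well-defined bilinear form. The discrete
  gradient and the face projection are themselves given by such equations, with \<open>L\<^sup>2\<close> inner
  products as forms (\<open>representer\<close>). All integrands are, on each cell and each face, polynomials that
  depend linearly on the unknowns (\<open>polynomial_operator\<close>). Hence all integrals converge, and
  because cells and faces carry measures that charge every relatively open part
  (\<open>bounded_full_measure_cell\<close>, \<open>bounded_full_measure_face\<close>), a polynomial whose square has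
  integral zero vanishes at every point.\<close>

section \<open>Function spaces as real vector spaces\<close>

instantiation "fun" :: (type, real_vector) real_vector
begin

definition scaleR_fun :: "real \<Rightarrow> ('a \<Rightarrow> 'b) \<Rightarrow> 'a \<Rightarrow> 'b" where
  "scaleR_fun c f = (\<lambda>x. c *\<^sub>R f x)"

instance
  by standard (simp_all add: scaleR_fun_def fun_eq_iff scaleR_add_left scaleR_add_right)

end

lemma scaleR_fun_apply [simp]: "(c *\<^sub>R f) x = c *\<^sub>R f x"
  by (simp add: scaleR_fun_def)

lemma sum_fun_apply: "(\<Sum>i\<in>I. g i) x = (\<Sum>i\<in>I. g i x)"
  by (induction I rule: infinite_finite_induct) auto

section \<open>Linear problems on finite-dimensional subspaces\<close>

definition finite_dim :: "'a::real_vector set \<Rightarrow> bool" where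
  "finite_dim V \<longleftrightarrow> (\<exists>B. finite B \<and> V \<subseteq> span B)"

lemma finite_dim_subset: "finite_dim W \<Longrightarrow> V \<subseteq> W \<Longrightarrow> finite_dim V"
  unfolding finite_dim_def by blast

lemma finite_dim_singleton: "finite_dim {b}"
  unfolding finite_dim_def by (intro exI[of _ "{b}"]) (auto intro: span_base)

lemma finite_dim_span: "finite_dim V \<Longrightarrow> finite_dim (span V)"
  unfolding finite_dim_def by (meson span_minimal subspace_span)

lemma finite_dim_linear_image:
  assumes "linear f" "finite_dim V"
  shows "finite_dim (f ` V)"
proof -
  obtain B where "finite B" "V \<subseteq> span B" using assms by (auto simp: finite_dim_def)
  moreover have "f ` span B = span (f ` B)" by (simp add: assms(1) linear_span_image)
  ultimately show ?thesis unfolding finite_dim_def by (metis finite_imageI image_mono)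
qed

lemma finite_dim_sum:
  assumes "finite I" "\<And>i. i \<in> I \<Longrightarrow> finite_dim (S i)"
    and "\<And>v. v \<in> V \<Longrightarrow> \<exists>g. (\<forall>i\<in>I. g i \<in> S i) \<and> v = (\<Sum>i\<in>I. g i)"
  shows "finite_dim V"
proof -
  obtain B where B: "\<And>i. i \<in> I \<Longrightarrow> finite (B i) \<and> S i \<subseteq> span (B i)"
    using assms(2) unfolding finite_dim_def by metis
  have "V \<subseteq> span (\<Union>i\<in>I. B i)"
  proof
    fix v assume "v \<in> V"
    then obtain g where g: "\<forall>i\<in>I. g i \<in> S i" "v = (\<Sum>i\<in>I. g i)" using assms(3) by blast
    have "g i \<in> span (\<Union>i\<in>I. B i)" if "i \<in> I" for i
    proof -
      have "B i \<subseteq> (\<Union>i\<in>I. B i)" using that by blast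
      then show ?thesis using g(1) B that span_mono by blast
    qed
    then show "v \<in> span (\<Union>i\<in>I. B i)" unfolding g(2) by (intro span_sum)
  qed
  moreover have "finite (\<Union>i\<in>I. B i)" using B assms(1) by blast
  ultimately show ?thesis unfolding finite_dim_def by blast
qed

lemma finite_dim_Times:
  assumes "finite_dim V" "finite_dim W"
  shows "finite_dim (V \<times> W)"
proof (rule finite_dim_sum)
  let ?S = "\<lambda>b. if b then (\<lambda>v. (v, 0)) ` V else (\<lambda>w. (0, w)) ` W"
  show "finite (UNIV :: bool set)" by simp
  show "finite_dim (?S b)" for b
    using assms by (auto intro!: finite_dim_linear_image linearI)
  show "\<exists>g. (\<forall>b\<in>UNIV. g b \<in> ?S b) \<and> p = (\<Sum>b\<in>UNIV. g b)" if "p \<in> V \<times> W" for p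
    using that
    by (intro exI[of _ "\<lambda>b. if b then (fst p, 0) else (0, snd p)"]) (auto simp: UNIV_bool)
qed

text \<open>The operators and forms of the scheme are linear only on the discrete spaces: for arbitrary
  functions the integrals, limits and derivatives in them need not exist. Linearity is
  therefore relative to a set of arguments.\<close>

definition linear_on_set :: "'a::real_vector set \<Rightarrow> ('a \<Rightarrow> 'b::real_vector) \<Rightarrow> bool" where
  "linear_on_set V L \<longleftrightarrow>
     (\<forall>u\<in>V. \<forall>v\<in>V. L (u + v) = L u + L v) \<and> (\<forall>c. \<forall>u\<in>V. L (c *\<^sub>R u) = c *\<^sub>R L u)"

lemma linear_on_setI:
  assumes "\<And>u v. u \<in> V \<Longrightarrow> v \<in> V \<Longrightarrow> L (u + v) = L u + L v"
    and "\<And>c u. u \<in> V \<Longrightarrow> L (c *\<^sub>R u) = c *\<^sub>R L u"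
  shows "linear_on_set V L"
  using assms by (simp add: linear_on_set_def)

lemma linear_on_set_add: "linear_on_set V L \<Longrightarrow> u \<in> V \<Longrightarrow> v \<in> V \<Longrightarrow> L (u + v) = L u + L v"
  and linear_on_set_scale: "linear_on_set V L \<Longrightarrow> u \<in> V \<Longrightarrow> L (c *\<^sub>R u) = c *\<^sub>R L u"
  by (simp_all add: linear_on_set_def)

lemma linear_on_set_0: "linear_on_set V L \<Longrightarrow> 0 \<in> V \<Longrightarrow> L 0 = 0"
  using linear_on_set_scale[of V L 0 0] by simp

lemma linear_on_set_diff:
  assumes "linear_on_set V L" "subspace V" "u \<in> V" "v \<in> V"
  shows "L (u - v) = L u - L v"
  using linear_on_set_add[OF assms(1), of "u - v" v] assms by (simp add: subspace_diff)

lemma linear_on_set_plus: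
  "linear_on_set V L \<Longrightarrow> linear_on_set V L' \<Longrightarrow> linear_on_set V (\<lambda>u. L u + L' u)"
  by (auto simp: linear_on_set_def scaleR_add_right)

lemma linear_on_set_minus:
  "linear_on_set V L \<Longrightarrow> linear_on_set V L' \<Longrightarrow> linear_on_set V (\<lambda>u. L u - L' u)"
  by (auto simp: linear_on_set_def scaleR_diff_right)

lemma linear_on_set_mult:
  fixes L :: "'a::real_vector \<Rightarrow> real"
  shows "linear_on_set V L \<Longrightarrow> linear_on_set V (\<lambda>u. c * L u)"
  by (auto simp: linear_on_set_def algebra_simps)

lemma linear_on_set_sum:
  "(\<And>i. i \<in> I \<Longrightarrow> linear_on_set V (L i)) \<Longrightarrow> linear_on_set V (\<lambda>u. \<Sum>i\<in>I. L i u)"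
  by (auto simp: linear_on_set_def sum.distrib scaleR_sum_right)

definition bilinear_on ::
    "'a::real_vector set \<Rightarrow> 'b::real_vector set \<Rightarrow> ('a \<Rightarrow> 'b \<Rightarrow> real) \<Rightarrow> bool" where
  "bilinear_on V W a \<longleftrightarrow>
     (\<forall>w\<in>W. linear_on_set V (\<lambda>v. a v w)) \<and> (\<forall>v\<in>V. linear_on_set W (a v))"

lemma bilinear_on_plus:
  "bilinear_on V W a \<Longrightarrow> bilinear_on V W b \<Longrightarrow> bilinear_on V W (\<lambda>v w. a v w + b v w)"
  by (auto simp: bilinear_on_def intro!: linear_on_set_plus)

lemma bilinear_on_mult: "bilinear_on V W a \<Longrightarrow> bilinear_on V W (\<lambda>v w. c * a v w)"
  by (auto simp: bilinear_on_def intro!: linear_on_set_mult)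

lemma bilinear_on_sum:
  "(\<And>i. i \<in> I \<Longrightarrow> bilinear_on V W (a i)) \<Longrightarrow> bilinear_on V W (\<lambda>v w. \<Sum>i\<in>I. a i v w)"
  by (auto simp: bilinear_on_def intro!: linear_on_set_sum)

lemma bilinear_on_compose:
  assumes "bilinear_on V W a" "linear_on_set V' f" "f ` V' \<subseteq> V" "linear_on_set W' g" "g ` W' \<subseteq> W"
  shows "bilinear_on V' W' (\<lambda>v w. a (f v) (g w))"
  using assms unfolding bilinear_on_def linear_on_set_def image_subset_iff by metis

lemma bilinear_on_cong:
  assumes "bilinear_on V W a" "subspace V" "subspace W" "\<And>v w. v \<in> V \<Longrightarrow> w \<in> W \<Longrightarrow> b v w = a v w"
  shows "bilinear_on V W b"
  using assms by (simp add: bilinear_on_def linear_on_set_def subspace_add subspace_scale)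

text \<open>Orthogonalisation replaces the usual dimension count: if \<open>g\<close> is the part of a new spanning
  vector that is \<open>a\<close>-orthogonal to the old span, then the equation on the larger span
  decouples into the old one and one scalar equation, solvable because \<open>a g g > 0\<close>. The form
  of the scheme is not symmetric; \<open>g\<close> is made orthogonal in the left argument, the place of the
  unknown, so that adding a multiple of \<open>g\<close> keeps the equations that already hold.\<close>

lemma galerkin_solvable_span:
  assumes "finite B" "bilinear_on (span B) (span B) a"
    and "\<And>v. v \<in> span B \<Longrightarrow> v \<noteq> 0 \<Longrightarrow> a v v > 0" "linear_on_set (span B) L"
  shows "\<exists>u\<in>span B. \<forall>w\<in>span B. a u w = L w"
  using assms
proof (induction B arbitrary: L rule: finite_induct)
  case empty
  then show ?case
    by (auto simp: bilinear_on_def linear_on_set_0)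
next
  case (insert e B)
  let ?W = "span B" and ?V = "span (insert e B)"
  have WV: "?W \<subseteq> ?V" by (simp add: span_mono subset_insertI)
  have eV: "e \<in> ?V" by (simp add: span_base)
  have sub: "bilinear_on ?W ?W a"
    using insert.prems(1) WV unfolding bilinear_on_def linear_on_set_def by (meson subsetD)
  have posW: "\<And>v. v \<in> ?W \<Longrightarrow> v \<noteq> 0 \<Longrightarrow> a v v > 0"
    using insert.prems(2) WV by blast
  have restr: "linear_on_set ?W M" if "linear_on_set ?V M" for M :: "'a \<Rightarrow> real"
    using that WV unfolding linear_on_set_def by (meson subsetD)
  have left: "linear_on_set ?V (\<lambda>v. a v w)" and right: "linear_on_set ?V (a w)" if "w \<in> ?V" for w
    using insert.prems(1) that by (auto simp: bilinear_on_def)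
  show ?case
  proof (cases "e \<in> ?W")
    case True
    then have "?V = ?W" by (simp add: span_redundant)
    then show ?thesis using insert.IH[OF sub posW restr[OF insert.prems(3)]] by simp
  next
    case False
    obtain u' where u': "u' \<in> ?W" "\<forall>w\<in>?W. a u' w = L w"
      using insert.IH[OF sub posW restr[OF insert.prems(3)]] by blast
    obtain z where z: "z \<in> ?W" "\<forall>w\<in>?W. a z w = a e w"
      using insert.IH[OF sub posW restr[OF right[OF eV]]] by blast
    define g where "g = e - z"
    have gV: "g \<in> ?V" unfolding g_def using eV z(1) WV by (meson span_diff subsetD)
    have "g \<noteq> 0" using False z(1) by (auto simp: g_def)
    then have gg: "a g g > 0" using insert.prems(2) gV by blast
    have orth: "a g w = 0" if "w \<in> ?W" for w
      using linear_on_set_diff[OF left subspace_span eV, of w z] that z WV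
      by (auto simp: g_def)
    define c where "c = (L g - a u' g) / a g g"
    define u where "u = u' + c *\<^sub>R g"
    have uV: "u \<in> ?V" unfolding u_def using u'(1) gV WV by (meson span_add span_scale subsetD)
    have a_u: "a u w = a u' w + c * a g w" if "w \<in> ?V" for w
      using linear_on_set_add[OF left[OF that], of u' "c *\<^sub>R g"]
        linear_on_set_scale[OF left[OF that], of g c] u'(1) gV WV
      by (auto simp: u_def span_scale)
    have "a u w = L w" if wV: "w \<in> ?V" for w
    proof -
      obtain k where "w - k *\<^sub>R e \<in> ?W" using wV unfolding span_breakdown_eq by blast
      then have w': "w - k *\<^sub>R g \<in> ?W"
        using span_add[of "w - k *\<^sub>R e" B "k *\<^sub>R z"] z(1) by (simp add: g_def span_scale algebra_simps)
      define w' where "w' = w - k *\<^sub>R g"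
      have w: "w = w' + k *\<^sub>R g" "w' \<in> ?W" "w' \<in> ?V" "k *\<^sub>R g \<in> ?V"
        using w' gV WV by (auto simp: w'_def span_scale)
      have "a u w' = L w'" using a_u[OF w(3)] orth[OF w(2)] u'(2) w(2) by simp
      moreover have "a u g = L g" using a_u[OF gV] gg by (simp add: c_def)
      moreover have "a u w = a u w' + k * a u g"
        unfolding w(1) using linear_on_set_add[OF right[OF uV] w(3,4)]
          linear_on_set_scale[OF right[OF uV] gV] by simp
      moreover have "L w = L w' + k * L g"
        unfolding w(1) using linear_on_set_add[OF insert.prems(3) w(3,4)]
          linear_on_set_scale[OF insert.prems(3) gV] by simp
      ultimately show ?thesis by simp
    qed
    then show ?thesis using uV by blast
  qed
qed

text \<open>The form of the Lax-Milgram theorem that a finite-dimensional Galerkin method needs. Uniqueness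
  is positivity applied to the difference of two solutions.\<close>

lemma galerkin_unique_solution:
  assumes V: "subspace V" "finite_dim V" and a: "bilinear_on V V a"
    and pos: "\<And>v. v \<in> V \<Longrightarrow> v \<noteq> 0 \<Longrightarrow> a v v > 0" and L: "linear_on_set V L"
  shows "\<exists>!u. u \<in> V \<and> (\<forall>w\<in>V. a u w = L w)"
proof (rule ex_ex1I)
  obtain B where B: "B \<subseteq> V" "independent B" "V \<subseteq> span B"
    using maximal_independent_subset by blast
  obtain C where "finite C" "V \<subseteq> span C" using V(2) by (auto simp: finite_dim_def)
  then have "finite B" using independent_span_bound[of C B] B by auto
  moreover have "V = span B" using B V(1) by (simp add: span_minimal subset_antisym)
  ultimately show "\<exists>u. u \<in> V \<and> (\<forall>w\<in>V. a u w = L w)"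
    using galerkin_solvable_span[of B a L] a pos L by blast
next
  fix u u' assume u: "u \<in> V \<and> (\<forall>w\<in>V. a u w = L w)" and u': "u' \<in> V \<and> (\<forall>w\<in>V. a u' w = L w)"
  have d: "u - u' \<in> V" using u u' V(1) by (simp add: subspace_diff)
  have "linear_on_set V (\<lambda>v. a v (u - u'))" using a d by (simp add: bilinear_on_def)
  from linear_on_set_diff[OF this V(1), of u u'] have "a (u - u') (u - u') = 0"
    using u u' d by simp
  then show "u = u'" using pos[OF d] by force
qed

definition representer :: "'b::real_vector set \<Rightarrow> ('b \<Rightarrow> 'b \<Rightarrow> real) \<Rightarrow> ('b \<Rightarrow> real) \<Rightarrow> 'b" where
  "representer V a L = (THE q. q \<in> V \<and> (\<forall>r\<in>V. a q r = L r))"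

text \<open>Both operators of the scheme that are given implicitly, the discrete gradient and the face
  projection, are instances of this: the defining equation has a unique solution that
  depends linearly on the data.\<close>

lemma representer:
  assumes V: "subspace V" "finite_dim V" and a: "bilinear_on V V a"
    and pos: "\<And>v. v \<in> V \<Longrightarrow> v \<noteq> 0 \<Longrightarrow> a v v > 0" and l: "bilinear_on W V l"
  shows "w \<in> W \<Longrightarrow> representer V a (l w) \<in> V"
    and "linear_on_set W (\<lambda>w. representer V a (l w))"
proof -
  note uniq = galerkin_unique_solution[OF V a pos]
  have ex: "\<exists>!q. q \<in> V \<and> (\<forall>r\<in>V. a q r = l w r)" if "w \<in> W" for w
    using uniq l that by (auto simp: bilinear_on_def)
  have R: "representer V a (l w) \<in> V" "\<And>r. r \<in> V \<Longrightarrow> a (representer V a (l w)) r = l w r"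
    if "w \<in> W" for w
    using theI'[OF ex[OF that]] by (auto simp: representer_def)
  show "w \<in> W \<Longrightarrow> representer V a (l w) \<in> V" using R(1) by blast
  have eqI: "representer V a L = q" if "q \<in> V" "\<And>r. r \<in> V \<Longrightarrow> a q r = L r" for q L
  proof -
    have "linear_on_set V L"
      using a that V(1) by (auto simp: bilinear_on_def linear_on_set_def subspace_add subspace_scale)
    then show ?thesis
      unfolding representer_def using uniq[of L] that by (intro the1_equality) auto
  qed
  show "linear_on_set W (\<lambda>w. representer V a (l w))"
  proof (rule linear_on_setI)
    fix u v assume uv: "u \<in> W" "v \<in> W"
    have "a (representer V a (l u) + representer V a (l v)) r = l (u + v) r" if "r \<in> V" for r
      using a l uv that R by (auto simp: bilinear_on_def linear_on_set_def)
    then show "representer V a (l (u + v)) = representer V a (l u) + representer V a (l v)"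
      using R(1) uv V(1) by (intro eqI) (auto simp: subspace_add)
  next
    fix c u assume u: "u \<in> W"
    have "a (c *\<^sub>R representer V a (l u)) r = l (c *\<^sub>R u) r" if "r \<in> V" for r
      using a l u that R by (auto simp: bilinear_on_def linear_on_set_def)
    then show "representer V a (l (c *\<^sub>R u)) = c *\<^sub>R representer V a (l u)"
      using R(1) u V(1) by (intro eqI) (auto simp: subspace_scale)
  qed
qed

section \<open>Polynomial integrands\<close>

text \<open>Values outside \<open>D\<close> are left open, because a piecewise polynomial agrees with a
  different polynomial on each cell.\<close>

definition polynomial_on :: "'a::euclidean_space set \<Rightarrow> ('a \<Rightarrow> real) \<Rightarrow> bool" where
  "polynomial_on D f \<longleftrightarrow> (\<exists>p. real_polynomial_function p \<and> (\<forall>x\<in>D. f x = p x))"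

lemma polynomial_onI: "real_polynomial_function p \<Longrightarrow> (\<And>x. x \<in> D \<Longrightarrow> f x = p x) \<Longrightarrow> polynomial_on D f"
  unfolding polynomial_on_def by blast

lemma polynomial_on_add:
  assumes "polynomial_on D f" "polynomial_on D g"
  shows "polynomial_on D (\<lambda>x. f x + g x)"
proof -
  obtain p q where "real_polynomial_function p" "real_polynomial_function q"
    "\<forall>x\<in>D. f x = p x" "\<forall>x\<in>D. g x = q x"
    using assms by (auto simp: polynomial_on_def)
  then show ?thesis by (intro polynomial_onI[OF real_polynomial_function.intros(3)]) auto
qed

lemma polynomial_on_mult:
  assumes "polynomial_on D f" "polynomial_on D g"
  shows "polynomial_on D (\<lambda>x. f x * g x)"
proof -
  obtain p q where "real_polynomial_function p" "real_polynomial_function q"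
    "\<forall>x\<in>D. f x = p x" "\<forall>x\<in>D. g x = q x"
    using assms by (auto simp: polynomial_on_def)
  then show ?thesis by (intro polynomial_onI[OF real_polynomial_function.intros(4)]) auto
qed

lemma polynomial_on_const: "polynomial_on D (\<lambda>x. c)"
  unfolding polynomial_on_def using real_polynomial_function.intros(2) by blast

lemma polynomial_on_minus:
  assumes "polynomial_on D f" "polynomial_on D g"
  shows "polynomial_on D (\<lambda>x. f x - g x)"
  using polynomial_on_add[OF assms(1) polynomial_on_mult[OF polynomial_on_const[of D "- 1"] assms(2)]]
  by simp

lemma polynomial_on_sum:
  "(\<And>i. i \<in> I \<Longrightarrow> polynomial_on D (f i)) \<Longrightarrow> polynomial_on D (\<lambda>x. \<Sum>i\<in>I. f i x)"
  by (induction I rule: infinite_finite_induct) (auto intro: polynomial_on_const polynomial_on_add)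

text \<open>The common shape of everything that is integrated in the scheme: restriction, differentiation,
  traces and face projection all map a discrete function to a polynomial on a cell or face, and
  do so linearly at each point. The lemma \<open>bilinear_on_integral\<close> makes a bilinear form
  out of any two of them.\<close>

definition polynomial_operator ::
    "'s::real_vector set \<Rightarrow> 'a::euclidean_space set \<Rightarrow> ('s \<Rightarrow> 'a \<Rightarrow> real) \<Rightarrow> bool" where
  "polynomial_operator S D A \<longleftrightarrow>
     (\<forall>u\<in>S. polynomial_on D (A u)) \<and> (\<forall>x\<in>D. linear_on_set S (\<lambda>u. A u x))"

lemma polynomial_operator_minus:
  "polynomial_operator S D A \<Longrightarrow> polynomial_operator S D B \<Longrightarrow>
     polynomial_operator S D (\<lambda>u x. A u x - B u x)"
  by (auto simp: polynomial_operator_def intro!: linear_on_set_minus polynomial_on_minus)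

lemma polynomial_operator_mult:
  "polynomial_on D g \<Longrightarrow> polynomial_operator S D A \<Longrightarrow> polynomial_operator S D (\<lambda>u x. g x * A u x)"
  by (auto simp: polynomial_operator_def intro!: linear_on_set_mult polynomial_on_mult)

lemma polynomial_operator_sum:
  "(\<And>i. i \<in> I \<Longrightarrow> polynomial_operator S D (A i)) \<Longrightarrow>
     polynomial_operator S D (\<lambda>u x. \<Sum>i\<in>I. A i u x)"
  by (auto simp: polynomial_operator_def intro!: linear_on_set_sum polynomial_on_sum)

lemma polynomial_operator_compose:
  assumes "polynomial_operator S D A" "linear_on_set S' f" "f ` S' \<subseteq> S"
  shows "polynomial_operator S' D (\<lambda>u. A (f u))"
  using assms unfolding polynomial_operator_def linear_on_set_def image_subset_iff by metis

lemma polynomial_operator_cong: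
  assumes "polynomial_operator S D A" "\<And>u x. u \<in> S \<Longrightarrow> x \<in> D \<Longrightarrow> B u x = A u x" "subspace S"
  shows "polynomial_operator S D B"
  using assms by (simp add: polynomial_operator_def polynomial_on_def linear_on_set_def
    subspace_add subspace_scale)

text \<open>The two kinds of measure in the scheme, volume on a cell and area on a face, enter the proof
  only through these properties. Full support is what makes the \<open>L\<^sup>2\<close> form definite on
  functions rather than on classes.\<close>

locale bounded_full_measure = finite_measure M for M :: "'a::euclidean_space measure" +
  assumes bounded_space: "bounded (space M)"
    and measurable_ident: "(\<lambda>x. x) \<in> borel_measurable M"
    and full_support: "open U \<Longrightarrow> U \<inter> space M \<noteq> {} \<Longrightarrow> emeasure M (U \<inter> space M) > 0"
begin

lemma measurable_polynomial:
  assumes "polynomial_on (space M) f"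
  shows "f \<in> borel_measurable M"
proof -
  obtain p where p: "real_polynomial_function p" "\<forall>x\<in>space M. f x = p x"
    using assms by (auto simp: polynomial_on_def)
  have "p \<in> borel_measurable borel"
    using p(1) by (intro borel_measurable_continuous_onI continuous_on_polymonial_function)
      (simp add: real_polynomial_function_eq)
  from measurable_compose[OF measurable_ident this] show ?thesis
    using p(2) by (simp cong: measurable_cong)
qed

lemma bounded_polynomial:
  assumes "polynomial_on (space M) f"
  obtains C where "\<And>x. x \<in> space M \<Longrightarrow> \<bar>f x\<bar> \<le> C"
proof -
  obtain p where p: "real_polynomial_function p" "\<forall>x\<in>space M. f x = p x"
    using assms by (auto simp: polynomial_on_def)
  have "compact (p ` closure (space M))"
    using p(1) bounded_space
    by (intro compact_continuous_image continuous_on_polymonial_function)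
      (auto simp: real_polynomial_function_eq compact_closure)
  then obtain C where "\<forall>y\<in>p ` closure (space M). \<bar>y\<bar> \<le> C"
    using compact_imp_bounded bounded_iff real_norm_def by metis
  then show ?thesis using that p(2) closure_subset by (metis imageI subsetD)
qed

lemma integrable_polynomial:
  assumes "polynomial_on (space M) f"
  shows "integrable M f"
proof -
  obtain C where "\<And>x. x \<in> space M \<Longrightarrow> \<bar>f x\<bar> \<le> C" using bounded_polynomial[OF assms] by blast
  then show ?thesis
    by (intro integrable_const_bound[where B=C] measurable_polynomial assms) auto
qed

text \<open>A polynomial with a nonzero value at \<open>x\<close> is nonzero on a neighbourhood of \<open>x\<close>, whose part in
  the space has positive measure.\<close>

lemma polynomial_eq_0:
  assumes f: "polynomial_on (space M) f" and 0: "(\<integral>x. f x * f x \<partial>M) = 0" and x: "x \<in> space M"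
  shows "f x = 0"
proof (rule ccontr)
  assume "f x \<noteq> 0"
  obtain p where p: "real_polynomial_function p" "\<forall>x\<in>space M. f x = p x"
    using f by (auto simp: polynomial_on_def)
  define U where "U = {y. p y \<noteq> 0}"
  have "continuous_on UNIV p"
    using p(1) by (intro continuous_on_polymonial_function) (simp add: real_polynomial_function_eq)
  then have U: "open U" unfolding U_def by (intro open_Collect_neq continuous_on_const)
  have "x \<in> U \<inter> space M" using x p(2) \<open>f x \<noteq> 0\<close> by (simp add: U_def)
  then have pos: "emeasure M (U \<inter> space M) > 0" using full_support[OF U] by blast
  have "AE y in M. f y * f y = 0"
    using 0 integral_nonneg_eq_0_iff_AE[OF integrable_polynomial[OF polynomial_on_mult[OF f f]]] by simp
  then have "AE y in M. y \<notin> U \<inter> space M"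
    by (rule AE_mp) (use p(2) in \<open>auto simp: U_def\<close>)
  moreover have "U \<inter> space M \<in> sets M"
    using measurable_sets[OF measurable_ident, of U] U by (simp add: vimage_def Int_def)
  ultimately have "emeasure M (U \<inter> space M) = 0"
    by (subst (asm) AE_iff_measurable[of "U \<inter> space M"]) auto
  then show False using pos by simp
qed

lemma bilinear_on_integral:
  assumes A: "polynomial_operator S (space M) A" and B: "polynomial_operator S' (space M) B"
  shows "bilinear_on S S' (\<lambda>u w. \<integral>x. A u x * B w x \<partial>M)"
proof -
  have int: "integrable M (\<lambda>x. A u x * B w x)" if "u \<in> S" "w \<in> S'" for u w
    using A B that by (intro integrable_polynomial polynomial_on_mult) (auto simp: polynomial_operator_def)
  have 1: "(\<integral>x. A (u + v) x * B w x \<partial>M) = (\<integral>x. A u x * B w x \<partial>M) + (\<integral>x. A v x * B w x \<partial>M)"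
    if "u \<in> S" "v \<in> S" "w \<in> S'" for u v w
    unfolding Bochner_Integration.integral_add[OF int[OF that(1,3)] int[OF that(2,3)], symmetric]
    using A that by (intro Bochner_Integration.integral_cong)
      (auto simp: polynomial_operator_def linear_on_set_def algebra_simps)
  have 2: "(\<integral>x. A (c *\<^sub>R u) x * B w x \<partial>M) = c * (\<integral>x. A u x * B w x \<partial>M)" if "u \<in> S" "w \<in> S'" for c u w
    unfolding Bochner_Integration.integral_mult_right_zero[symmetric]
    using A that by (intro Bochner_Integration.integral_cong)
      (auto simp: polynomial_operator_def linear_on_set_def algebra_simps)
  have 3: "(\<integral>x. A u x * B (v + w) x \<partial>M) = (\<integral>x. A u x * B v x \<partial>M) + (\<integral>x. A u x * B w x \<partial>M)"
    if "u \<in> S" "v \<in> S'" "w \<in> S'" for u v w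
    unfolding Bochner_Integration.integral_add[OF int[OF that(1,2)] int[OF that(1,3)], symmetric]
    using B that by (intro Bochner_Integration.integral_cong)
      (auto simp: polynomial_operator_def linear_on_set_def algebra_simps)
  have 4: "(\<integral>x. A u x * B (c *\<^sub>R w) x \<partial>M) = c * (\<integral>x. A u x * B w x \<partial>M)" if "u \<in> S" "w \<in> S'" for c u w
    unfolding Bochner_Integration.integral_mult_right_zero[symmetric]
    using B that by (intro Bochner_Integration.integral_cong)
      (auto simp: polynomial_operator_def linear_on_set_def algebra_simps)
  show ?thesis using 1 2 3 4 by (simp add: bilinear_on_def linear_on_set_def)
qed

end

section \<open>Volume on cells and area on faces\<close>

lemma polyhedral_bounded:
  assumes "polyhedral S"
  shows "bounded S"
proof -
  obtain P where P: "finite P" "\<forall>p\<in>P. polytope p" "closure S = \<Union>P"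
    using assms by (auto simp: polyhedral_def)
  then have "bounded (closure S)" by (simp add: bounded_Union polytope_imp_bounded)
  then show ?thesis using bounded_subset closure_subset by blast
qed

lemma bounded_full_measure_cell:
  fixes K :: "'a::euclidean_space set"
  assumes "open K" "bounded K"
  shows "bounded_full_measure (lebesgue_on K)"
proof -
  have K: "K \<in> lmeasurable" using assms by (simp add: lmeasurable_open)
  interpret finite_measure "lebesgue_on K" using K by (rule finite_measure_lebesgue_on)
  show ?thesis
  proof
    show "bounded (space (lebesgue_on K))" using assms(2) by (simp add: space_restrict_space)
    show "(\<lambda>x. x) \<in> borel_measurable (lebesgue_on K)"
      by (rule measurable_restrict_space1, rule measurable_completion) simp
    fix U :: "'a set" assume U: "open U" "U \<inter> space (lebesgue_on K) \<noteq> {}"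
    have "emeasure (lebesgue_on K) (U \<inter> K) = emeasure lebesgue (U \<inter> K)"
      using assms U by (subst emeasure_restrict_space) auto
    moreover have "emeasure lebesgue (U \<inter> K) \<noteq> 0"
      using open_not_negligible[of "U \<inter> K"] assms(1) U
      by (auto simp: negligible_iff_emeasure0 space_restrict_space open_Int)
    ultimately show "emeasure (lebesgue_on K) (U \<inter> space (lebesgue_on K)) > 0"
      by (simp add: space_restrict_space zero_less_iff_neq_zero)
  qed
qed

text \<open>Codimension one makes the affine hull of a face a hyperplane, so that a unit normal exists, and
  any unit vector orthogonal to the face describes that hyperplane.\<close>

lemma unit_normal:
  fixes E :: "'a::euclidean_space set"
  assumes "aff_dim E = int DIM('a) - 1" "a \<in> E"
  shows "norm (unit_normal E) = 1" "affine hull E = {x. unit_normal E \<bullet> (x - a) = 0}"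
proof -
  have dim: "aff_dim E = int (DIM('a) - 1)"
    using assms(1) DIM_positive[where 'a='a] by (simp add: of_nat_diff Suc_leI)
  obtain m b where m: "m \<noteq> 0" "affine hull E = {x. m \<bullet> x = b}"
    using iffD1[OF aff_dim_eq_hyperplane dim] by blast
  have "m \<bullet> x = b" if "x \<in> E" for x using m(2) that hull_inc by fastforce
  then have "\<forall>x\<in>E. \<forall>y\<in>E. (m /\<^sub>R norm m) \<bullet> (x - y) = 0" by (simp add: inner_diff_right)
  moreover have "norm (m /\<^sub>R norm m) = 1" using m(1) by simp
  ultimately have "\<exists>n. norm n = 1 \<and> (\<forall>x\<in>E. \<forall>y\<in>E. n \<bullet> (x - y) = 0)" by blast
  then have "norm (unit_normal E) = 1 \<and> (\<forall>x\<in>E. \<forall>y\<in>E. unit_normal E \<bullet> (x - y) = 0)"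
    unfolding unit_normal_def by (rule someI_ex)
  then have n: "norm (unit_normal E) = 1" "\<forall>x\<in>E. \<forall>y\<in>E. unit_normal E \<bullet> (x - y) = 0" by blast+
  show "norm (unit_normal E) = 1" by (fact n(1))
  define H where "H = {x. unit_normal E \<bullet> (x - a) = 0}"
  have H: "H = {x. unit_normal E \<bullet> x = unit_normal E \<bullet> a}" by (auto simp: H_def inner_diff_right)
  have "affine hull E = H"
  proof (rule affine_dim_equal)
    show "affine H" unfolding H by (rule affine_hyperplane)
    then show "affine hull E \<subseteq> H" using n(2) assms(2) by (intro hull_minimal) (auto simp: H_def)
    show "aff_dim (affine hull E) = aff_dim H"
      unfolding H using n(1) assms(1) by (subst aff_dim_hyperplane) auto
  qed (use assms(2) in auto)
  then show "affine hull E = {x. unit_normal E \<bullet> (x - a) = 0}" by (simp add: H_def)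
qed

text \<open>The prism over a face has the face as its continuous image under orthogonal projection. Over
  a relatively open part of the face it contains a nonempty open set, whence full support.\<close>

lemma bounded_full_measure_face:
  fixes E :: "'a::euclidean_space set"
  assumes E: "polyhedral E" "aff_dim E = int DIM('a) - 1"
  shows "bounded_full_measure (surface_measure E)" "space (surface_measure E) = E"
proof -
  define n where "n = unit_normal E"
  define a where "a = (SOME a. a \<in> E)"
  define \<phi> where "\<phi> = (\<lambda>y. y - ((y - a) \<bullet> n) *\<^sub>R n)"
  define P where "P = {x + t *\<^sub>R n | x t. x \<in> E \<and> 0 \<le> t \<and> t \<le> 1}"
  define \<sigma> where "\<sigma> = surface_measure E"
  have \<sigma>: "\<sigma> = distr (lebesgue_on P) (restrict_space borel E) \<phi>"
    by (simp add: \<sigma>_def surface_measure_def n_def a_def \<phi>_def P_def Let_def)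
  show sp: "space (surface_measure E) = E"
    unfolding \<sigma>_def[symmetric] \<sigma> by (simp add: space_restrict_space)
  have aE: "a \<in> E" using E(1) some_in_eq unfolding a_def polyhedral_def by metis
  have n: "n \<bullet> n = 1" and aff: "affine hull E = {x. n \<bullet> (x - a) = 0}"
    using unit_normal[OF E(2) aE] by (auto simp: n_def norm_eq_1)
  have "openin (top_of_set (affine hull E)) E"
    using E(1) openin_rel_interior[of "closure E"] by (simp add: polyhedral_def)
  then obtain G where G: "open G" "E = affine hull E \<inter> G" by (auto simp: openin_open)
  have \<phi>_hull: "\<phi> y \<in> affine hull E" for y
    using n by (simp add: aff \<phi>_def inner_diff_right inner_commute)
  have \<phi>_id: "\<phi> (x + t *\<^sub>R n) = x" and height: "(x + t *\<^sub>R n - a) \<bullet> n = t" if "x \<in> E" for x t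
  proof -
    have "n \<bullet> (x - a) = 0" using that hull_inc[of x E] aff by auto
    then show "(x + t *\<^sub>R n - a) \<bullet> n = t" using n
      by (simp add: inner_diff_left inner_add_left inner_diff_right inner_commute[of x n] inner_commute[of a n])
    then show "\<phi> (x + t *\<^sub>R n) = x" by (simp add: \<phi>_def)
  qed
  have P_eq: "P = {y. \<phi> y \<in> G \<and> 0 \<le> (y - a) \<bullet> n \<and> (y - a) \<bullet> n \<le> 1}"
  proof (intro equalityI subsetI)
    fix y assume "y \<in> P"
    then obtain x t where "y = x + t *\<^sub>R n" "x \<in> E" "0 \<le> t" "t \<le> 1" by (auto simp: P_def)
    then show "y \<in> {y. \<phi> y \<in> G \<and> 0 \<le> (y - a) \<bullet> n \<and> (y - a) \<bullet> n \<le> 1}"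
      using \<phi>_id height G(2) by auto
  next
    fix y assume y: "y \<in> {y. \<phi> y \<in> G \<and> 0 \<le> (y - a) \<bullet> n \<and> (y - a) \<bullet> n \<le> 1}"
    then have "\<phi> y \<in> E" using G(2) \<phi>_hull by auto
    moreover have "y = \<phi> y + ((y - a) \<bullet> n) *\<^sub>R n" by (simp add: \<phi>_def)
    ultimately show "y \<in> P" using y unfolding P_def by blast
  qed
  have cont: "continuous_on UNIV \<phi>" "continuous_on UNIV (\<lambda>y. (y - a) \<bullet> n)"
    unfolding \<phi>_def by (intro continuous_intros)+
  have P_borel: "P \<in> sets borel"
  proof -
    have "open (\<phi> -` G)" using cont(1) G(1) by (simp add: continuous_on_open_vimage)
    moreover have "closed {y. 0 \<le> (y - a) \<bullet> n \<and> (y - a) \<bullet> n \<le> 1}"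
      by (intro closed_Collect_conj closed_Collect_le continuous_on_const cont)
    moreover have "P = \<phi> -` G \<inter> {y. 0 \<le> (y - a) \<bullet> n \<and> (y - a) \<bullet> n \<le> 1}" by (auto simp: P_eq)
    ultimately show ?thesis by auto
  qed
  have "bounded P"
  proof -
    obtain c where "\<And>x. x \<in> E \<Longrightarrow> norm x \<le> c"
      using polyhedral_bounded[OF E(1)] by (auto simp: bounded_iff)
    moreover have "norm n = 1" using n by (simp add: norm_eq_1)
    ultimately have "norm y \<le> c + 1" if "y \<in> P" for y
      using that norm_triangle_mono[of _ c] unfolding P_def by fastforce
    then show ?thesis by (auto simp: bounded_iff)
  qed
  then have P_lmeas: "P \<in> lmeasurable"
    using P_borel by (simp add: bounded_set_imp_lmeasurable)
  have \<phi>_meas: "\<phi> \<in> measurable (lebesgue_on P) (restrict_space borel E)"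
  proof (rule measurable_restrict_space2)
    show "\<phi> \<in> space (lebesgue_on P) \<rightarrow> E"
      using \<phi>_id by (auto simp: space_restrict_space P_def)
    have "\<phi> \<in> borel_measurable borel" using cont(1) by (rule borel_measurable_continuous_onI)
    then show "\<phi> \<in> borel_measurable (lebesgue_on P)"
      by (intro measurable_restrict_space1) (simp add: measurable_completion)
  qed
  interpret P: finite_measure "lebesgue_on P" using P_lmeas by (rule finite_measure_lebesgue_on)
  interpret finite_measure \<sigma> unfolding \<sigma> using \<phi>_meas by (rule P.finite_measure_distr)
  show "bounded_full_measure (surface_measure E)"
    unfolding \<sigma>_def[symmetric]
  proof
    show "bounded (space \<sigma>)" using polyhedral_bounded[OF E(1)] sp by (simp add: \<sigma>_def)
    show "(\<lambda>x. x) \<in> borel_measurable \<sigma>"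
      unfolding \<sigma> measurable_distr_eq1 by (rule measurable_restrict_space1) simp
    fix U :: "'a set" assume U: "open U" "U \<inter> space \<sigma> \<noteq> {}"
    then obtain x where x: "x \<in> U" "x \<in> E" using sp by (auto simp: \<sigma>_def)
    \<comment> \<open>The open prism over the part of the face in \<open>U\<close>; it contains the point at height one half
      above \<open>x\<close>.\<close>
    define O' where "O' = \<phi> -` (U \<inter> G) \<inter> {y. 0 < (y - a) \<bullet> n \<and> (y - a) \<bullet> n < 1}"
    have "open (\<phi> -` (U \<inter> G))" using cont(1) G(1) U(1) by (intro open_vimage) auto
    then have "open O'"
      unfolding O'_def by (intro open_Int open_Collect_conj open_Collect_less continuous_on_const cont)
    moreover have "x + (1/2) *\<^sub>R n \<in> O'"
      using x \<phi>_id[OF x(2)] height[OF x(2)] G(2) by (auto simp: O'_def)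
    ultimately have O'_pos: "emeasure lebesgue O' \<noteq> 0"
      using open_not_negligible[of O'] by (auto simp: negligible_iff_emeasure0)
    have UE: "U \<inter> E \<in> sets (restrict_space borel E)"
      using U(1) by (auto simp: sets_restrict_space)
    have pre: "\<phi> -` (U \<inter> E) \<inter> space (lebesgue_on P) \<in> sets (lebesgue_on P)"
      using measurable_sets[OF \<phi>_meas UE] .
    have "emeasure \<sigma> (U \<inter> E) = emeasure (lebesgue_on P) (\<phi> -` (U \<inter> E) \<inter> P)"
      unfolding \<sigma> using emeasure_distr[OF \<phi>_meas UE] by (simp add: space_restrict_space)
    also have "\<dots> = emeasure lebesgue (\<phi> -` (U \<inter> E) \<inter> P)"
      using P_borel by (intro emeasure_restrict_space) auto
    also have "\<dots> \<ge> emeasure lebesgue O'"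
    proof (rule emeasure_mono)
      show "O' \<subseteq> \<phi> -` (U \<inter> E) \<inter> P" using G(2) \<phi>_hull by (auto simp: O'_def P_eq)
      show "\<phi> -` (U \<inter> E) \<inter> P \<in> sets lebesgue"
        using pre P_borel by (auto simp: space_restrict_space sets_restrict_space_iff)
    qed
    finally have "emeasure lebesgue O' \<le> emeasure \<sigma> (U \<inter> E)" .
    moreover have "emeasure lebesgue O' > 0" using O'_pos by (simp add: zero_less_iff_neq_zero)
    ultimately have "emeasure \<sigma> (U \<inter> E) > 0" by (rule less_le_trans[rotated])
    then show "emeasure \<sigma> (U \<inter> space \<sigma>) > 0" using sp by (simp add: \<sigma>_def)
  qed
qed

section \<open>Derivatives and traces of piecewise polynomials\<close>

lemma real_polynomial_function_derivative:
  assumes "real_polynomial_function p"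
  shows "\<exists>D. \<forall>x. (p has_derivative D x) (at x) \<and> (\<forall>v. real_polynomial_function (\<lambda>x. D x v))"
  using assms
proof induction
  case (linear f)
  then show ?case
    by (intro exI[of _ "\<lambda>x. f"]) (auto intro: bounded_linear_imp_has_derivative real_polynomial_function.intros(2))
next
  case (const c)
  then show ?case
    by (intro exI[of _ "\<lambda>x v. 0"]) (auto intro: real_polynomial_function.intros(2))
next
  case (add f g)
  then obtain D E where "\<forall>x. (f has_derivative D x) (at x) \<and> (\<forall>v. real_polynomial_function (\<lambda>x. D x v))"
    "\<forall>x. (g has_derivative E x) (at x) \<and> (\<forall>v. real_polynomial_function (\<lambda>x. E x v))" by blast
  then show ?case
    by (intro exI[of _ "\<lambda>x v. D x v + E x v"])
      (auto intro: has_derivative_add real_polynomial_function.intros(3))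
next
  case (mult f g)
  then obtain D E where "\<forall>x. (f has_derivative D x) (at x) \<and> (\<forall>v. real_polynomial_function (\<lambda>x. D x v))"
    "\<forall>x. (g has_derivative E x) (at x) \<and> (\<forall>v. real_polynomial_function (\<lambda>x. E x v))" by blast
  with mult show ?case
    by (intro exI[of _ "\<lambda>x v. f x * E x v + D x v * g x"])
      (auto intro!: has_derivative_mult real_polynomial_function.intros(3,4))
qed

lemma polynomial_on_derivative:
  assumes "open K" "polynomial_on K u"
  obtains D where "\<And>x. x \<in> K \<Longrightarrow> (u has_derivative D x) (at x)" "\<And>v. polynomial_on K (\<lambda>x. D x v)"
proof -
  obtain p where p: "real_polynomial_function p" "\<forall>x\<in>K. u x = p x"
    using assms(2) by (auto simp: polynomial_on_def)
  obtain D where D: "\<And>x. (p has_derivative D x) (at x)" "\<And>v. real_polynomial_function (\<lambda>x. D x v)"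
    using real_polynomial_function_derivative[OF p(1)] by blast
  show ?thesis
  proof
    show "(u has_derivative D x) (at x)" if "x \<in> K" for x
      using has_derivative_transform_within_open[OF D(1) assms(1) that] p(2) by simp
    show "polynomial_on K (\<lambda>x. D x v)" for v using D(2) by (rule polynomial_onI) simp
  qed
qed

text \<open>A boundary point of an open set is a limit point of it, so the limit that defines the trace is
  unique.\<close>

lemma trace_from_eq:
  assumes "open K" "x \<in> frontier K" "isCont p x" "\<And>y. y \<in> K \<Longrightarrow> v y = p y"
  shows "trace_from K v x = p x"
proof -
  have "x islimpt K"
    using assms(1,2) by (auto simp: frontier_def interior_open closure_def)
  then have nontriv: "at x within K \<noteq> bot" by (simp add: trivial_limit_within)
  have "(p \<longlongrightarrow> p x) (at x within K)"
    using assms(3) by (simp add: isCont_def tendsto_within_subset[OF _ subset_UNIV])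
  then have "(v \<longlongrightarrow> p x) (at x within K)"
    by (rule Lim_transform_eventually) (simp add: eventually_at_filter assms(4))
  then show ?thesis unfolding trace_from_def using nontriv by (intro tendsto_Lim)
qed

lemma isCont_real_polynomial_function: "real_polynomial_function p \<Longrightarrow> isCont p x"
  by (simp add: continuous_polymonial_function real_polynomial_function_eq)

text \<open>The limit operator is not additive on arbitrary functions. On piecewise polynomials the trace is
  the value of the polynomial extension, which is.\<close>

lemma polynomial_operator_trace:
  assumes A: "polynomial_operator S K (\<lambda>u. u)" and K: "open K" "E \<subseteq> frontier K" and S: "subspace S"
  shows "polynomial_operator S E (trace_from K)"
proof -
  have ext: "\<exists>p. real_polynomial_function p \<and> (\<forall>y\<in>K. u y = p y)" if "u \<in> S" for u
    using A that by (auto simp: polynomial_operator_def polynomial_on_def)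
  have tr: "trace_from K u x = p x" if "real_polynomial_function p" "\<forall>y\<in>K. u y = p y" "x \<in> E" for u p x
    using trace_from_eq[OF K(1) _ isCont_real_polynomial_function[OF that(1)]] that K(2) by auto
  show ?thesis
    unfolding polynomial_operator_def
  proof (intro conjI ballI linear_on_setI)
    fix u assume "u \<in> S"
    then obtain p where p: "real_polynomial_function p" "\<forall>y\<in>K. u y = p y" using ext by blast
    then show "polynomial_on E (trace_from K u)" using tr by (intro polynomial_onI[of p])
    fix x assume x: "x \<in> E"
    fix c
    have "trace_from K (c *\<^sub>R u) x = c * p x"
      by (rule tr[of "\<lambda>x. c * p x"]) (use p x in \<open>auto intro: real_polynomial_function.intros\<close>)
    then show "trace_from K (c *\<^sub>R u) x = c *\<^sub>R trace_from K u x" using tr[OF p x] by simp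
  next
    fix u v x assume "u \<in> S" "v \<in> S" and x: "x \<in> E"
    then obtain p q where p: "real_polynomial_function p" "\<forall>y\<in>K. u y = p y"
      and q: "real_polynomial_function q" "\<forall>y\<in>K. v y = q y" using ext by metis
    have "trace_from K (u + v) x = p x + q x"
      by (rule tr[of "\<lambda>x. p x + q x"]) (use p q x in \<open>auto intro: real_polynomial_function.intros\<close>)
    then show "trace_from K (u + v) x = trace_from K u x + trace_from K v x"
      using tr[OF p x] tr[OF q x] by simp
  qed
qed

lemma trace_from_component:
  fixes r :: "'a::euclidean_space \<Rightarrow> real^'d"
  assumes "\<And>i. polynomial_on K (\<lambda>x. r x $ i)" "open K" "x \<in> frontier K"
  shows "trace_from K r x $ i = trace_from K (\<lambda>y. r y $ i) x"
proof -
  obtain p where p: "\<And>i. real_polynomial_function (p i)" "\<And>i y. y \<in> K \<Longrightarrow> r y $ i = p i y"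
    using assms(1) unfolding polynomial_on_def by metis
  have "isCont (\<lambda>y. \<chi> i. p i y) x"
    using isCont_real_polynomial_function[OF p(1)] unfolding isCont_def by (intro tendsto_vec_lambda)
  from trace_from_eq[OF assms(2,3) this, of r] have "trace_from K r x = (\<chi> i. p i x)"
    using p(2) by (simp add: vec_eq_iff)
  moreover have "trace_from K (\<lambda>y. r y $ i) x = p i x"
    by (rule trace_from_eq[OF assms(2,3) isCont_real_polynomial_function[OF p(1)]]) (rule p(2))
  ultimately show ?thesis by simp
qed

lemma polynomial_operator_gradient:
  fixes S :: "(real^'d \<Rightarrow> real) set"
  assumes A: "polynomial_operator S K (\<lambda>u. u)" and K: "open K" and S: "subspace S"
  shows "polynomial_operator S K (\<lambda>u x. gradient u x $ i)"
proof -
  have der: "\<exists>D. (\<forall>x\<in>K. (u has_derivative D x) (at x)) \<and> (\<forall>v. polynomial_on K (\<lambda>x. D x v))"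
    if "u \<in> S" for u
    using polynomial_on_derivative[OF K, of u] A that unfolding polynomial_operator_def by metis
  have grad: "gradient u x $ i = D (axis i 1)" if "(u has_derivative D) (at x)" for u D x
    using frechet_derivative_at[OF that] by (simp add: gradient_def)
  show ?thesis
    unfolding polynomial_operator_def
  proof (intro conjI ballI linear_on_setI)
    fix u assume "u \<in> S"
    then obtain D where D: "\<forall>x\<in>K. (u has_derivative D x) (at x)" "\<forall>v. polynomial_on K (\<lambda>x. D x v)"
      using der by blast
    then show "polynomial_on K (\<lambda>x. gradient u x $ i)" using grad unfolding polynomial_on_def by metis
    fix x assume x: "x \<in> K"
    fix c
    have "((c *\<^sub>R u) has_derivative (\<lambda>h. c *\<^sub>R D x h)) (at x)"
      unfolding scaleR_fun_def using D x by (intro has_derivative_scaleR_right) auto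
    then show "gradient (c *\<^sub>R u) x $ i = c *\<^sub>R gradient u x $ i"
      using grad D(1) x by (metis real_scaleR_def)
  next
    fix u v x assume "u \<in> S" "v \<in> S" and x: "x \<in> K"
    then obtain D D' where D: "(u has_derivative D) (at x)" "(v has_derivative D') (at x)"
      using der by metis
    then have "((u + v) has_derivative (\<lambda>h. D h + D' h)) (at x)"
      unfolding plus_fun_def by (rule has_derivative_add)
    then show "gradient (u + v) x $ i = gradient u x $ i + gradient v x $ i" using grad D by metis
  qed
qed

lemma divergence_eq:
  fixes r :: "real^'d \<Rightarrow> real^'d"
  assumes "\<And>i. (\<lambda>x. r x $ i) differentiable (at x)"
  shows "divergence r x = (\<Sum>i\<in>UNIV. gradient (\<lambda>x. r x $ i) x $ i)"
proof -
  have c: "((\<lambda>x. r x $ i) has_derivative frechet_derivative (\<lambda>x. r x $ i) (at x)) (at x)" for i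
    using assms frechet_derivative_works by blast
  have "(r has_derivative (\<lambda>h. \<chi> i. frechet_derivative (\<lambda>x. r x $ i) (at x) h)) (at x)"
    unfolding has_derivative_componentwise_within[of r]
  proof
    fix b :: "real^'d" assume "b \<in> Basis"
    then obtain i where "b = axis i 1" by (auto simp: Basis_vec_def)
    then show "((\<lambda>x. r x \<bullet> b) has_derivative
        (\<lambda>h. (\<chi> i. frechet_derivative (\<lambda>x. r x $ i) (at x) h) \<bullet> b)) (at x)"
      using c[of i] by (simp add: inner_axis)
  qed
  from frechet_derivative_at[OF this, symmetric] show ?thesis
    by (simp add: divergence_def gradient_def)
qed

section \<open>The discrete spaces\<close>

lemma linear_zero_ext: "linear (zero_ext D :: ('a \<Rightarrow> 'b::real_vector) \<Rightarrow> _)"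
  by (rule linearI) (auto simp: zero_ext_def fun_eq_iff)

lemmas zero_ext_linear = linear_add[OF linear_zero_ext] linear_scale[OF linear_zero_ext] linear_0[OF linear_zero_ext]

lemma subspace_poly_space: "subspace (poly_space m)"
  unfolding poly_space_def
  by (intro linear_subspace_image linearI)
    (auto simp: fun_eq_iff sum.distrib sum_distrib_left algebra_simps)

lemma finite_multi_indices: "finite {\<alpha> :: 'd::finite \<Rightarrow> nat. (\<Sum>i\<in>UNIV. \<alpha> i) \<le> m}" (is "finite ?I")
proof -
  have "\<alpha> i \<le> m" if "\<alpha> \<in> ?I" for \<alpha> i
    using that member_le_sum[of i UNIV \<alpha>] by simp
  then have "?I \<subseteq> PiE UNIV (\<lambda>_. {..m})" by auto
  then show ?thesis by (rule finite_subset) (simp add: finite_PiE)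
qed

lemma finite_dim_poly_space: "finite_dim (poly_space m :: (real^'d \<Rightarrow> real) set)"
proof (rule finite_dim_sum)
  let ?I = "{\<alpha> :: 'd \<Rightarrow> nat. (\<Sum>i\<in>UNIV. \<alpha> i) \<le> m}"
  let ?mono = "\<lambda>\<alpha> :: 'd \<Rightarrow> nat. \<lambda>x :: real^'d. \<Prod>i\<in>UNIV. (x $ i) ^ \<alpha> i"
  show "finite ?I" by (rule finite_multi_indices)
  show "finite_dim (span {?mono \<alpha>})" for \<alpha>
    by (intro finite_dim_span finite_dim_singleton)
  fix p :: "real^'d \<Rightarrow> real" assume "p \<in> poly_space m"
  then obtain c where "p = (\<lambda>x. \<Sum>\<alpha>\<in>?I. c \<alpha> * ?mono \<alpha> x)" by (auto simp: poly_space_def)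
  then have "p = (\<Sum>\<alpha>\<in>?I. c \<alpha> *\<^sub>R ?mono \<alpha>)" by (simp add: fun_eq_iff sum_fun_apply)
  moreover have "\<forall>\<alpha>\<in>?I. c \<alpha> *\<^sub>R ?mono \<alpha> \<in> span {?mono \<alpha>}" by (simp add: span_scale span_base)
  ultimately show "\<exists>g. (\<forall>\<alpha>\<in>?I. g \<alpha> \<in> span {?mono \<alpha>}) \<and> p = (\<Sum>\<alpha>\<in>?I. g \<alpha>)"
    by (intro exI[of _ "\<lambda>\<alpha>. c \<alpha> *\<^sub>R ?mono \<alpha>"]) simp
qed

lemma poly_space_imp_polynomial:
  fixes p :: "real^'d \<Rightarrow> real"
  assumes "p \<in> poly_space m"
  shows "real_polynomial_function p"
proof -
  have "real_polynomial_function (\<lambda>x :: real^'d. (x $ i) ^ n)" for i n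
    by (intro real_polynomial_function_power real_polynomial_function.intros(1) bounded_linear_vec_nth)
  then have "real_polynomial_function (\<lambda>x :: real^'d. \<Sum>\<alpha>\<in>I. c \<alpha> * (\<Prod>i\<in>UNIV. (x $ i) ^ \<alpha> i))"
    if "finite I" for I and c :: "('d \<Rightarrow> nat) \<Rightarrow> real"
    using that by (intro real_polynomial_function_sum real_polynomial_function_prod
      real_polynomial_function.intros(2,4)) auto
  note sum = this[OF finite_multi_indices]
  show ?thesis using assms unfolding poly_space_def by (elim rangeE) (simp only: sum)
qed

lemma subspace_poly_on: "subspace (poly_on m D)"
  unfolding poly_on_def by (intro linear_subspace_image linear_zero_ext subspace_poly_space)

lemma finite_dim_poly_on: "finite_dim (poly_on m D)"
  unfolding poly_on_def by (intro finite_dim_linear_image linear_zero_ext finite_dim_poly_space)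

lemma poly_on_imp_polynomial_on:
  assumes "zero_ext D f \<in> poly_on m D"
  shows "polynomial_on D f"
proof -
  obtain p where p: "p \<in> poly_space m" "zero_ext D f = zero_ext D p" using assms by (auto simp: poly_on_def)
  have "f x = p x" if "x \<in> D" for x using fun_cong[OF p(2), of x] that by (simp add: zero_ext_def)
  then show ?thesis using poly_space_imp_polynomial[OF p(1)] by (rule polynomial_onI[rotated])
qed

lemma zero_ext_poly_on: "p \<in> poly_on m D \<Longrightarrow> zero_ext D p = p"
  by (auto simp: poly_on_def zero_ext_def)

lemma subspace_L2: "subspace (L2 M)"
proof (rule subspaceI)
  show "0 \<in> L2 M" by (simp add: L2_def zero_fun_def)
next
  fix f g :: "'a \<Rightarrow> 'b" assume "f \<in> L2 M" "g \<in> L2 M"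
  then have m: "f \<in> borel_measurable M" "g \<in> borel_measurable M"
    and i: "integrable M (\<lambda>x. (norm (f x))\<^sup>2)" "integrable M (\<lambda>x. (norm (g x))\<^sup>2)"
    by (auto simp: L2_def)
  have "integrable M (\<lambda>x. (norm (f x + g x))\<^sup>2)"
  proof (rule Bochner_Integration.integrable_bound)
    show "integrable M (\<lambda>x. 2 * (norm (f x))\<^sup>2 + 2 * (norm (g x))\<^sup>2)" using i by simp
    show "(\<lambda>x. (norm (f x + g x))\<^sup>2) \<in> borel_measurable M" using m by measurable
    have "(norm (f x + g x))\<^sup>2 \<le> 2 * (norm (f x))\<^sup>2 + 2 * (norm (g x))\<^sup>2" for x
    proof -
      have "(norm (f x + g x))\<^sup>2 \<le> (norm (f x) + norm (g x))\<^sup>2"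
        by (intro power_mono norm_triangle_ineq) simp
      also have "\<dots> \<le> 2 * (norm (f x))\<^sup>2 + 2 * (norm (g x))\<^sup>2"
        using sum_squares_bound[of "norm (f x)" "norm (g x)"] by (simp add: power2_sum)
      finally show ?thesis .
    qed
    then show "AE x in M. norm ((norm (f x + g x))\<^sup>2) \<le> norm (2 * (norm (f x))\<^sup>2 + 2 * (norm (g x))\<^sup>2)"
      by simp
  qed
  then show "f + g \<in> L2 M" using m by (simp add: L2_def plus_fun_def)
next
  fix c and f :: "'a \<Rightarrow> 'b" assume "f \<in> L2 M"
  then show "c *\<^sub>R f \<in> L2 M" by (auto simp: L2_def scaleR_fun_def power_mult_distrib)
qed

lemma subspace_V_space: "subspace (V_space k \<Omega> \<T>)"
  unfolding V_space_def
  by (rule subspaceI)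
    (auto simp: zero_ext_linear subspace_add[OF subspace_L2] subspace_scale[OF subspace_L2] subspace_0[OF subspace_L2]
      subspace_add[OF subspace_poly_on] subspace_scale[OF subspace_poly_on] subspace_0[OF subspace_poly_on])

lemma subspace_Vhat_space: "subspace (Vhat_space l \<Omega> \<E>)"
  unfolding Vhat_space_def
  by (rule subspaceI)
    (auto simp: zero_ext_linear subspace_add[OF subspace_L2] subspace_scale[OF subspace_L2] subspace_0[OF subspace_L2]
      subspace_add[OF subspace_poly_on] subspace_scale[OF subspace_poly_on] subspace_0[OF subspace_poly_on])

lemma subspace_Q_space: "subspace (Q_space k \<Omega> \<T>)"
proof -
  have c: "zero_ext K (\<lambda>x. (q + r) x $ i) = zero_ext K (\<lambda>x. q x $ i) + zero_ext K (\<lambda>x. r x $ i)"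
    "zero_ext K (\<lambda>x. (a *\<^sub>R q) x $ i) = a *\<^sub>R zero_ext K (\<lambda>x. q x $ i)"
    "zero_ext K (\<lambda>x. (0 :: real^'d \<Rightarrow> real^'d) x $ i) = 0"
    for K i a and q r :: "real^'d \<Rightarrow> real^'d"
    by (auto simp: zero_ext_def fun_eq_iff)
  show ?thesis
    unfolding Q_space_def
    by (rule subspaceI)
      (auto simp: c zero_ext_linear subspace_add[OF subspace_L2] subspace_scale[OF subspace_L2] subspace_0[OF subspace_L2]
        subspace_add[OF subspace_poly_on] subspace_scale[OF subspace_poly_on] subspace_0[OF subspace_poly_on]
        simp del: plus_fun_apply scaleR_fun_apply zero_fun_apply)
qed

text \<open>This splits a discrete function into one polynomial per cell or face, which bounds the
  dimension of the discrete spaces.\<close>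

lemma zero_ext_decompose:
  fixes v :: "'a \<Rightarrow> 'b::real_vector"
  assumes "finite \<T>" "pairwise disjnt \<T>" "zero_ext (\<Union>\<T>) v = v"
  shows "v = (\<Sum>K\<in>\<T>. zero_ext K v)"
proof
  fix x
  show "v x = (\<Sum>K\<in>\<T>. zero_ext K v) x"
  proof (cases "x \<in> \<Union>\<T>")
    case True
    then obtain K where K: "K \<in> \<T>" "x \<in> K" by blast
    have "(\<Sum>L\<in>\<T>. zero_ext L v x) = (\<Sum>L\<in>\<T>. if L = K then v x else 0)"
    proof (rule sum.cong[OF refl])
      fix L assume "L \<in> \<T>"
      then have "x \<in> L \<longleftrightarrow> L = K" using K assms(2) by (auto simp: pairwise_def disjnt_def)
      then show "zero_ext L v x = (if L = K then v x else 0)" by (simp add: zero_ext_def)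
    qed
    then show ?thesis using K assms(1) by (simp add: sum_fun_apply)
  next
    case False
    then have "v x = 0" using assms(3) by (metis zero_ext_def)
    moreover have "zero_ext K v x = 0" if "K \<in> \<T>" for K using False that by (auto simp: zero_ext_def)
    ultimately show ?thesis by (simp add: sum_fun_apply)
  qed
qed

lemma finite_dim_piecewise_polynomial:
  assumes "finite \<T>" "pairwise disjnt \<T>"
  shows "finite_dim {v. (\<forall>K\<in>\<T>. zero_ext K v \<in> poly_on m K) \<and> zero_ext (\<Union>\<T>) v = v}"
proof (rule finite_dim_sum[where S = "poly_on m", OF assms(1) finite_dim_poly_on])
  fix v assume "v \<in> {v. (\<forall>K\<in>\<T>. zero_ext K v \<in> poly_on m K) \<and> zero_ext (\<Union>\<T>) v = v}"
  then show "\<exists>g. (\<forall>K\<in>\<T>. g K \<in> poly_on m K) \<and> v = (\<Sum>K\<in>\<T>. g K)"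
    using zero_ext_decompose[OF assms, of v] by (intro exI[of _ "\<lambda>K. zero_ext K v"] conjI) auto
qed

lemma finite_dim_V_space:
  assumes "finite \<T>" "pairwise disjnt \<T>"
  shows "finite_dim (V_space k \<Omega> \<T>)"
  by (rule finite_dim_subset[OF finite_dim_piecewise_polynomial[OF assms]]) (auto simp: V_space_def)

lemma finite_dim_Vhat_space:
  assumes "finite \<E>" "pairwise disjnt \<E>"
  shows "finite_dim (Vhat_space l \<Omega> \<E>)"
  by (rule finite_dim_subset[OF finite_dim_piecewise_polynomial[OF assms]]) (auto simp: Vhat_space_def)

lemma finite_dim_Q_space:
  assumes "finite \<T>" "pairwise disjnt \<T>"
  shows "finite_dim (Q_space k \<Omega> \<T> :: (real^'d \<Rightarrow> real^'d) set)"
proof (rule finite_dim_sum[where I = UNIV])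
  let ?P = "{v. (\<forall>K\<in>\<T>. zero_ext K v \<in> poly_on (k - 1) K) \<and> zero_ext (\<Union>\<T>) v = v}"
  let ?e = "\<lambda>i :: 'd. \<lambda>(g :: real^'d \<Rightarrow> real) x. g x *\<^sub>R (axis i 1 :: real^'d)"
  show "finite_dim (?e i ` ?P)" for i
    by (intro finite_dim_linear_image finite_dim_piecewise_polynomial assms linearI)
      (auto simp: fun_eq_iff algebra_simps)
  fix q :: "real^'d \<Rightarrow> real^'d" assume q: "q \<in> Q_space k \<Omega> \<T>"
  have "(\<Sum>i\<in>UNIV. q x $ i *\<^sub>R (axis i 1 :: real^'d)) = q x" for x
    using basis_expansion[of "q x"] by (simp add: scalar_mult_eq_scaleR)
  then have "q = (\<Sum>i\<in>UNIV. ?e i (\<lambda>x. q x $ i))"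
    by (simp add: fun_eq_iff sum_fun_apply)
  moreover have "(\<lambda>x. q x $ i) \<in> ?P" for i
  proof -
    have "zero_ext (\<Union>\<T>) (\<lambda>x. q x $ i) = (\<lambda>x. q x $ i)"
    proof
      fix x
      have "zero_ext (\<Union>\<T>) q x = q x" using q by (simp add: Q_space_def)
      then show "zero_ext (\<Union>\<T>) (\<lambda>x. q x $ i) x = q x $ i"
        by (metis zero_ext_def zero_index)
    qed
    then show ?thesis using q by (simp add: Q_space_def)
  qed
  ultimately show "\<exists>g. (\<forall>i\<in>UNIV. g i \<in> ?e i ` ?P) \<and> q = (\<Sum>i\<in>UNIV. g i)"
    by (intro exI[of _ "\<lambda>i. ?e i (\<lambda>x. q x $ i)"] conjI ballI) (rule imageI)
qed simp

lemma polynomial_operator_V_space: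
  "K \<in> \<T> \<Longrightarrow> polynomial_operator (V_space k \<Omega> \<T>) K (\<lambda>u. u)"
  by (auto simp: polynomial_operator_def V_space_def linear_on_set_def intro: poly_on_imp_polynomial_on)

lemma polynomial_operator_Vhat_space:
  "E \<in> \<E> \<Longrightarrow> polynomial_operator (Vhat_space l \<Omega> \<E>) E (\<lambda>\<mu>. \<mu>)"
  by (auto simp: polynomial_operator_def Vhat_space_def linear_on_set_def intro: poly_on_imp_polynomial_on)

lemma polynomial_operator_Q_space:
  "K \<in> \<T> \<Longrightarrow> polynomial_operator (Q_space k \<Omega> \<T>) K (\<lambda>q x. q x $ i)"
  by (auto simp: polynomial_operator_def Q_space_def linear_on_set_def intro: poly_on_imp_polynomial_on)

lemma polynomial_operator_poly_on: "polynomial_operator (poly_on m D) D (\<lambda>p. p)"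
  by (auto simp: polynomial_operator_def linear_on_set_def zero_ext_poly_on intro: poly_on_imp_polynomial_on)

section \<open>The forms of the scheme on a mesh\<close>

lemma b_vec_inner: "b_vec c \<bullet> y = c * (\<Sum>i\<in>UNIV. y $ i)"
  by (simp add: b_vec_def inner_vec_def sum_distrib_left)

text \<open>A ball that contains two points at distance \<open>e\<close> has diameter at least \<open>e\<close>.\<close>

lemma mesh_size_pos:
  fixes K :: "'a::euclidean_space set"
  assumes "open K" "bounded K" "K \<noteq> {}"
  shows "mesh_size K > 0"
proof -
  obtain x where x: "x \<in> K" using assms(3) by blast
  then obtain e where e: "e > 0" "cball x e \<subseteq> K" using assms(1) open_contains_cball by blast
  obtain b :: 'a where b: "norm b = 1" using norm_Basis nonempty_Basis by blast
  have y: "x + e *\<^sub>R b \<in> K" using e b by (auto simp: dist_norm)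
  have "e \<le> mesh_size K"
    unfolding mesh_size_def
  proof (rule cInf_greatest)
    obtain c r where "K \<subseteq> cball c r" using assms(2) bounded_subset_cball by blast
    then show "{2 * r |r. \<exists>c. K \<subseteq> cball c r} \<noteq> {}" by blast
    fix d assume "d \<in> {2 * r |r. \<exists>c. K \<subseteq> cball c r}"
    then obtain r c where d: "d = 2 * r" "K \<subseteq> cball c r" by blast
    have "e = dist x (x + e *\<^sub>R b)" using e b by (simp add: dist_norm)
    also have "\<dots> \<le> dist c x + dist c (x + e *\<^sub>R b)" by (rule dist_triangle3)
    also have "\<dots> \<le> r + r" using d(2) x y by (intro add_mono) auto
    finally show "e \<le> d" using d(1) by simp
  qed
  then show ?thesis using e(1) by simp
qed

lemma integrable_L2_mult:
  fixes f g :: "'a \<Rightarrow> real"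
  assumes "f \<in> L2 M" "g \<in> L2 M"
  shows "integrable M (\<lambda>x. f x * g x)"
proof (rule Bochner_Integration.integrable_bound)
  show "integrable M (\<lambda>x. (norm (f x))\<^sup>2 + (norm (g x))\<^sup>2)" using assms by (simp add: L2_def)
  have "f \<in> borel_measurable M" "g \<in> borel_measurable M" using assms by (simp_all add: L2_def)
  then show "(\<lambda>x. f x * g x) \<in> borel_measurable M" by (rule borel_measurable_times)
  have "\<bar>f x * g x\<bar> \<le> (f x)\<^sup>2 + (g x)\<^sup>2" for x
  proof -
    have "2 * (\<bar>f x\<bar> * \<bar>g x\<bar>) \<le> (f x)\<^sup>2 + (g x)\<^sup>2"
      using sum_squares_bound[of "\<bar>f x\<bar>" "\<bar>g x\<bar>"] by simp
    moreover have "0 \<le> \<bar>f x\<bar> * \<bar>g x\<bar>" by simp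
    ultimately show ?thesis unfolding abs_mult by linarith
  qed
  then show "AE x in M. norm (f x * g x) \<le> norm ((norm (f x))\<^sup>2 + (norm (g x))\<^sup>2)" by simp
qed

lemma L2_restrict:
  fixes f :: "'a::euclidean_space \<Rightarrow> 'b::{banach, second_countable_topology}"
  assumes "f \<in> L2 (lebesgue_on \<Omega>)" "open K" "open \<Omega>" "K \<subseteq> \<Omega>"
  shows "f \<in> L2 (lebesgue_on K)"
proof -
  have K: "K \<in> sets lebesgue" "\<Omega> \<in> sets lebesgue" using assms(2,3) by auto
  have f: "f \<in> borel_measurable (lebesgue_on \<Omega>)" "integrable (lebesgue_on \<Omega>) (\<lambda>x. (norm (f x))\<^sup>2)"
    using assms(1) by (simp_all add: L2_def)
  have "f \<in> borel_measurable (lebesgue_on K)"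
    using f(1) assms(4) by (rule measurable_restrict_mono)
  moreover have iff: "integrable (lebesgue_on S) (\<lambda>x. (norm (f x))\<^sup>2) \<longleftrightarrow>
      set_integrable lebesgue S (\<lambda>x. (norm (f x))\<^sup>2)" if "S \<in> sets lebesgue" for S
    unfolding set_integrable_def using that by (intro integrable_restrict_space) simp
  have "integrable (lebesgue_on K) (\<lambda>x. (norm (f x))\<^sup>2)"
    using f(2) set_integrable_subset[OF _ K(1) assms(4)] unfolding iff[OF K(1)] iff[OF K(2)] by blast
  ultimately show ?thesis by (simp add: L2_def)
qed

locale mesh =
  fixes \<Omega> :: "(real^'d) set" and \<T> \<E> :: "(real^'d) set set"
  assumes mesh: "polytopal_mesh \<Omega> \<T> \<E>"
begin

lemma finite_cells: "finite \<T>" and disjoint_cells: "pairwise disjnt \<T>"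
  and finite_faces: "finite \<E>" and disjoint_faces: "pairwise disjnt \<E>"
  using mesh by (auto simp: polytopal_mesh_def)

lemma cell:
  assumes "K \<in> \<T>"
  shows "open K" "bounded K" "K \<noteq> {}" "K \<subseteq> \<Omega>"
    and "bounded_full_measure (lebesgue_on K)" "space (lebesgue_on K) = K"
proof -
  show K: "open K" "bounded K" "K \<noteq> {}" "K \<subseteq> \<Omega>"
    using mesh assms polyhedral_bounded[of K] by (auto simp: polytopal_mesh_def polyhedral_def)
  show "bounded_full_measure (lebesgue_on K)" using K by (intro bounded_full_measure_cell)
  show "space (lebesgue_on K) = K" by (simp add: space_restrict_space)
qed

lemma face:
  assumes "F \<in> \<E>"
  shows "bounded_full_measure (surface_measure F)" "space (surface_measure F) = F"
  using mesh assms bounded_full_measure_face[of F] by (auto simp: polytopal_mesh_def)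

lemma faces_of_D: "F \<in> faces_of \<E> K \<Longrightarrow> F \<in> \<E>" "F \<in> faces_of \<E> K \<Longrightarrow> F \<subseteq> frontier K"
  and finite_faces_of: "finite (faces_of \<E> K)"
  using finite_faces by (auto simp: faces_of_def)

text \<open>This is what lets the penalty on the cell boundaries control the unknown on all of the skeleton.\<close>

lemma face_has_cell: "F \<in> \<E> \<Longrightarrow> \<exists>K\<in>\<T>. F \<in> faces_of \<E> K"
  using mesh by (auto simp: polytopal_mesh_def faces_of_def)

lemma bilinear_on_cells:
  assumes "\<And>K. K \<in> \<T> \<Longrightarrow> polynomial_operator S K A" "\<And>K. K \<in> \<T> \<Longrightarrow> polynomial_operator S' K B"
  shows "bilinear_on S S' (\<lambda>u w. cell_inner \<T> (A u) (B w))"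
  unfolding cell_inner_def inner_real_def
  by (intro bilinear_on_sum bounded_full_measure.bilinear_on_integral[OF cell(5)])
    (simp_all add: cell(6) assms)

lemma bilinear_on_faces:
  assumes "\<And>K F. K \<in> \<T> \<Longrightarrow> F \<in> faces_of \<E> K \<Longrightarrow> polynomial_operator S F (A K F)"
    and "\<And>K F. K \<in> \<T> \<Longrightarrow> F \<in> faces_of \<E> K \<Longrightarrow> polynomial_operator S' F (B K F)"
  shows "bilinear_on S S' (\<lambda>u w. bdry_inner \<T> \<E> (\<lambda>K F. A K F u) (\<lambda>K F. B K F w))"
  unfolding bdry_inner_def
  by (intro bilinear_on_sum bounded_full_measure.bilinear_on_integral[OF face(1)])
    (auto simp: face(2)[OF faces_of_D(1)] assms dest: faces_of_D(1))

lemma polynomial_operator_trace_V: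
  "K \<in> \<T> \<Longrightarrow> F \<in> faces_of \<E> K \<Longrightarrow> polynomial_operator (V_space k \<Omega> \<T>) F (trace_from K)"
  by (intro polynomial_operator_trace[where K = K] polynomial_operator_V_space cell(1) subspace_V_space faces_of_D(2))

lemma cell_inner_nonneg: "cell_inner \<T> u u \<ge> 0"
  unfolding cell_inner_def by (intro sum_nonneg integral_nonneg_AE) auto

lemma bilinear_V: "bilinear_on (V_space k \<Omega> \<T>) (V_space k \<Omega> \<T>) (cell_inner \<T>)"
  using bilinear_on_cells[OF polynomial_operator_V_space polynomial_operator_V_space] by simp

lemma cell_inner_definite_V:
  assumes u: "u \<in> V_space k \<Omega> \<T>" and 0: "cell_inner \<T> u u = 0"
  shows "u = 0"
proof -
  have "u x = 0" if "K \<in> \<T>" "x \<in> K" for K x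
  proof -
    have "(\<integral>x. u x * u x \<partial>lebesgue_on K) = 0"
      using 0 that(1) finite_cells unfolding cell_inner_def
      by (subst (asm) sum_nonneg_eq_0_iff) (auto intro: integral_nonneg_AE)
    then show ?thesis
      using bounded_full_measure.polynomial_eq_0[OF cell(5)[OF that(1)], of u x]
        polynomial_operator_V_space[OF that(1), of k \<Omega>] u that
      by (simp add: cell(6) polynomial_operator_def)
  qed
  moreover have "zero_ext (\<Union>\<T>) u = u" using u by (simp add: V_space_def)
  ultimately show ?thesis by (metis UnionE ext zero_ext_def zero_fun_apply)
qed

lemma cell_inner_Q:
  assumes "q \<in> Q_space k \<Omega> \<T>" "r \<in> Q_space k \<Omega> \<T>"
  shows "cell_inner \<T> q r = (\<Sum>i\<in>UNIV. cell_inner \<T> (\<lambda>x. q x $ i) (\<lambda>x. r x $ i))"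
proof -
  have "(\<integral>x. q x \<bullet> r x \<partial>lebesgue_on K) = (\<Sum>i\<in>UNIV. \<integral>x. q x $ i \<bullet> r x $ i \<partial>lebesgue_on K)"
    if "K \<in> \<T>" for K
    unfolding inner_vec_def
    using polynomial_operator_Q_space[OF that, of k \<Omega>] assms cell(6)[OF that]
    by (intro Bochner_Integration.integral_sum)
      (auto simp: polynomial_operator_def
        intro!: bounded_full_measure.integrable_polynomial[OF cell(5)[OF that]] polynomial_on_mult)
  then show ?thesis unfolding cell_inner_def by (subst sum.swap) simp
qed

lemma bilinear_Q: "bilinear_on (Q_space k \<Omega> \<T>) (Q_space k \<Omega> \<T>) (cell_inner \<T>)"
  by (rule bilinear_on_cong[OF bilinear_on_sum[where I = UNIV and a = "\<lambda>i q r. cell_inner \<T> (\<lambda>x. q x $ i) (\<lambda>x. r x $ i)"]])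
    (auto intro: subspace_Q_space cell_inner_Q bilinear_on_cells polynomial_operator_Q_space)

lemma cell_inner_definite_Q:
  assumes q: "q \<in> Q_space k \<Omega> \<T>" and 0: "cell_inner \<T> q q = 0"
  shows "q = 0"
proof -
  have "q x $ i = 0" if "K \<in> \<T>" "x \<in> K" for K x i
  proof -
    have "cell_inner \<T> (\<lambda>x. q x $ i) (\<lambda>x. q x $ i) = 0"
      using 0 unfolding cell_inner_Q[OF q q]
      by (subst (asm) sum_nonneg_eq_0_iff) (auto intro: cell_inner_nonneg)
    then have "(\<integral>x. q x $ i * q x $ i \<partial>lebesgue_on K) = 0"
      using that(1) finite_cells unfolding cell_inner_def
      by (subst (asm) sum_nonneg_eq_0_iff) (auto intro: integral_nonneg_AE)
    then show ?thesis
      using bounded_full_measure.polynomial_eq_0[OF cell(5)[OF that(1)], of "\<lambda>x. q x $ i" x]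
        polynomial_operator_Q_space[OF that(1), of k \<Omega>] q that
      by (simp add: cell(6) polynomial_operator_def)
  qed
  then have "q x = 0" if "K \<in> \<T>" "x \<in> K" for K x using that by (simp add: vec_eq_iff)
  moreover have "zero_ext (\<Union>\<T>) q = q" using q by (simp add: Q_space_def)
  ultimately show ?thesis by (metis UnionE ext zero_ext_def zero_fun_apply)
qed

lemma polynomial_operator_divergence:
  assumes K: "K \<in> \<T>"
  shows "polynomial_operator (Q_space k \<Omega> \<T>) K divergence"
proof (rule polynomial_operator_cong)
  have comp: "polynomial_operator ((\<lambda>q x. q x $ i) ` Q_space k \<Omega> \<T>) K (\<lambda>u. u)" for i
    using polynomial_operator_Q_space[OF K, of k \<Omega> i]
    by (auto simp: polynomial_operator_def linear_on_set_def)
  have lin: "linear (\<lambda>(q :: real^'d \<Rightarrow> real^'d) x. q x $ i)" for i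
    by (rule linearI) (auto simp: fun_eq_iff)
  have "polynomial_operator (Q_space k \<Omega> \<T>) K (\<lambda>q x. gradient (\<lambda>x. q x $ i) x $ i)" for i
    by (rule polynomial_operator_compose[OF
        polynomial_operator_gradient[OF comp cell(1)[OF K] linear_subspace_image[OF lin subspace_Q_space]]])
      (auto simp: linear_on_set_def fun_eq_iff plus_fun_def scaleR_fun_def)
  then show "polynomial_operator (Q_space k \<Omega> \<T>) K
      (\<lambda>q x. \<Sum>i\<in>UNIV. gradient (\<lambda>x. q x $ i) x $ i)"
    by (intro polynomial_operator_sum)
  show "divergence r x = (\<Sum>i\<in>UNIV. gradient (\<lambda>x. r x $ i) x $ i)"
    if "r \<in> Q_space k \<Omega> \<T>" "x \<in> K" for r x
  proof (rule divergence_eq)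
    fix i
    have "polynomial_on K (\<lambda>x. r x $ i)"
      using polynomial_operator_Q_space[OF K] that(1) by (auto simp: polynomial_operator_def)
    then show "(\<lambda>x. r x $ i) differentiable (at x)"
      using polynomial_on_derivative[OF cell(1)[OF K]] that(2) unfolding differentiable_def by metis
  qed
qed (rule subspace_Q_space)

lemma polynomial_operator_normal_trace:
  assumes K: "K \<in> \<T>" "F \<in> faces_of \<E> K"
  shows "polynomial_operator (Q_space k \<Omega> \<T>) F (\<lambda>r x. trace_from K r x \<bullet> c)"
proof (rule polynomial_operator_cong)
  have comp: "polynomial_operator ((\<lambda>q x. q x $ i) ` Q_space k \<Omega> \<T>) K (\<lambda>u. u)" for i
    using polynomial_operator_Q_space[OF K(1), of k \<Omega> i]
    by (auto simp: polynomial_operator_def linear_on_set_def)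
  have lin: "linear (\<lambda>(q :: real^'d \<Rightarrow> real^'d) x. q x $ i)" for i
    by (rule linearI) (auto simp: fun_eq_iff)
  have "polynomial_operator (Q_space k \<Omega> \<T>) F (\<lambda>q. trace_from K (\<lambda>x. q x $ i))" for i
    by (rule polynomial_operator_compose[OF polynomial_operator_trace[OF comp cell(1)[OF K(1)]
        faces_of_D(2)[OF K(2)] linear_subspace_image[OF lin subspace_Q_space]]])
      (auto simp: linear_on_set_def fun_eq_iff)
  then show "polynomial_operator (Q_space k \<Omega> \<T>) F
      (\<lambda>r x. \<Sum>i\<in>UNIV. c $ i * trace_from K (\<lambda>x. r x $ i) x)"
    by (intro polynomial_operator_sum polynomial_operator_mult polynomial_on_const)
  show "trace_from K r x \<bullet> c = (\<Sum>i\<in>UNIV. c $ i * trace_from K (\<lambda>x. r x $ i) x)"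
    if "r \<in> Q_space k \<Omega> \<T>" "x \<in> F" for r x
  proof -
    have "polynomial_on K (\<lambda>x. r x $ i)" for i
      using polynomial_operator_Q_space[OF K(1)] that(1) by (auto simp: polynomial_operator_def)
    then have "trace_from K r x $ i = trace_from K (\<lambda>x. r x $ i) x" for i
      using trace_from_component[OF _ cell(1)[OF K(1)]] faces_of_D(2)[OF K(2)] that(2) by blast
    then show ?thesis by (simp add: inner_vec_def mult.commute)
  qed
qed (rule subspace_Q_space)

lemma face_proj_eq_representer:
  "face_proj l F g = representer (poly_on l F) (\<lambda>p q. \<integral>x. p x * q x \<partial>surface_measure F)
     (\<lambda>q. \<integral>x. g x * q x \<partial>surface_measure F)"
  by (simp add: face_proj_def representer_def)

text \<open>The projection is the solution of a Galerkin equation in the polynomials on the face, whose form,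
  the \<open>L\<^sup>2\<close> product on the face, is definite by full support.\<close>

lemma polynomial_operator_face_proj:
  assumes K: "K \<in> \<T>" "F \<in> faces_of \<E> K"
  shows "polynomial_operator (V_space k \<Omega> \<T>) F (\<lambda>u. face_proj l F (trace_from K u))"
proof -
  interpret F: bounded_full_measure "surface_measure F" using face(1) faces_of_D(1)[OF K(2)] by blast
  have sp: "space (surface_measure F) = F" using face(2) faces_of_D(1)[OF K(2)] by blast
  let ?a = "\<lambda>p q. \<integral>x. p x * q x \<partial>surface_measure F"
  have a: "bilinear_on (poly_on l F) (poly_on l F) ?a"
    by (intro F.bilinear_on_integral) (simp_all add: sp polynomial_operator_poly_on)
  have pos: "?a p p > 0" if p: "p \<in> poly_on l F" "p \<noteq> 0" for p
  proof -
    have "?a p p \<noteq> 0"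
    proof
      assume "?a p p = 0"
      moreover have "polynomial_on F p"
        using polynomial_operator_poly_on[of l F] p(1) by (simp add: polynomial_operator_def)
      ultimately have "p x = 0" if "x \<in> F" for x
        using F.polynomial_eq_0[of p x] that by (simp add: sp)
      then have "zero_ext F p = 0" by (auto simp: zero_ext_def)
      then show False using p zero_ext_poly_on by metis
    qed
    moreover have "?a p p \<ge> 0" by (intro integral_nonneg_AE) auto
    ultimately show ?thesis by (simp only: less_le) auto
  qed
  have l: "bilinear_on (V_space k \<Omega> \<T>) (poly_on l F)
      (\<lambda>u q. \<integral>x. trace_from K u x * q x \<partial>surface_measure F)"
    by (intro F.bilinear_on_integral) (simp_all add: sp polynomial_operator_poly_on polynomial_operator_trace_V[OF K])
  note rep = representer[OF subspace_poly_on finite_dim_poly_on a pos l, folded face_proj_eq_representer]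
  show ?thesis
    using rep polynomial_operator_poly_on[of l F]
    by (auto simp: polynomial_operator_def linear_on_set_def)
qed

definition K_rhs :: "(real^'d \<Rightarrow> real) \<times> (real^'d \<Rightarrow> real) \<Rightarrow> (real^'d \<Rightarrow> real^'d) \<Rightarrow> real" where
  "K_rhs s r = - cell_inner \<T> (fst s) (divergence r)
     + bdry_inner \<T> \<E> (\<lambda>K F. snd s) (\<lambda>K F x. trace_from K r x \<bullet> outward_normal K F)"

definition trial_space :: "nat \<Rightarrow> nat \<Rightarrow> ((real^'d \<Rightarrow> real) \<times> (real^'d \<Rightarrow> real)) set" where
  "trial_space k l = V_space k \<Omega> \<T> \<times> Vhat_space l \<Omega> \<E>"

lemma subspace_trial_space: "subspace (trial_space k l)"
  unfolding trial_space_def by (intro subspace_Times subspace_V_space subspace_Vhat_space)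

lemma finite_dim_trial_space: "finite_dim (trial_space k l)"
  unfolding trial_space_def
  by (intro finite_dim_Times finite_dim_V_space finite_dim_Vhat_space finite_cells finite_faces
    disjoint_cells disjoint_faces)

lemma linear_on_fst: "linear_on_set S fst" and linear_on_snd: "linear_on_set S snd"
  by (simp_all add: linear_on_set_def)

lemma polynomial_operator_fst:
  "polynomial_operator (V_space k \<Omega> \<T>) D A \<Longrightarrow> polynomial_operator (trial_space k l) D (\<lambda>s. A (fst s))"
  by (erule polynomial_operator_compose) (auto simp: trial_space_def intro: linear_on_fst)

lemma polynomial_operator_snd:
  "polynomial_operator (Vhat_space l \<Omega> \<E>) D A \<Longrightarrow> polynomial_operator (trial_space k l) D (\<lambda>s. A (snd s))"
  by (erule polynomial_operator_compose) (auto simp: trial_space_def intro: linear_on_snd)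

lemma polynomial_operator_snd_face:
  "F \<in> faces_of \<E> K \<Longrightarrow> polynomial_operator (trial_space k l) F snd"
  using polynomial_operator_snd[OF polynomial_operator_Vhat_space[OF faces_of_D(1)], of F K k l] by simp

text \<open>The discrete gradient represents \<open>K_rhs\<close> with respect to the \<open>L\<^sup>2\<close> product on the flux
  space.\<close>

lemma K_op:
  shows "s \<in> trial_space k l \<Longrightarrow> K_op k \<Omega> \<T> \<E> (fst s) (snd s) \<in> Q_space k \<Omega> \<T>"
    and "linear_on_set (trial_space k l) (\<lambda>s. K_op k \<Omega> \<T> \<E> (fst s) (snd s))"
proof -
  have eq: "K_op k \<Omega> \<T> \<E> (fst s) (snd s) = representer (Q_space k \<Omega> \<T>) (cell_inner \<T>) (K_rhs s)" for s
    by (simp add: K_op_def representer_def K_rhs_def)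
  have pos: "cell_inner \<T> q q > 0" if "q \<in> Q_space k \<Omega> \<T>" "q \<noteq> 0" for q
    using cell_inner_definite_Q[OF that(1)] cell_inner_nonneg[of q] that(2) by fastforce
  have "bilinear_on (trial_space k l) (Q_space k \<Omega> \<T>)
      (\<lambda>s r. - 1 * cell_inner \<T> (fst s) (divergence r)
        + bdry_inner \<T> \<E> (\<lambda>K F. snd s) (\<lambda>K F x. trace_from K r x \<bullet> outward_normal K F))"
    by (intro bilinear_on_plus bilinear_on_mult bilinear_on_cells bilinear_on_faces
      polynomial_operator_divergence polynomial_operator_normal_trace
      polynomial_operator_fst polynomial_operator_V_space polynomial_operator_snd_face)
  then have rhs: "bilinear_on (trial_space k l) (Q_space k \<Omega> \<T>) K_rhs"
    by (simp add: K_rhs_def[abs_def])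
  note rep = representer[OF subspace_Q_space finite_dim_Q_space[OF finite_cells disjoint_cells]
    bilinear_Q pos rhs]
  show "s \<in> trial_space k l \<Longrightarrow> K_op k \<Omega> \<T> \<E> (fst s) (snd s) \<in> Q_space k \<Omega> \<T>"
    unfolding eq by (rule rep(1))
  show "linear_on_set (trial_space k l) (\<lambda>s. K_op k \<Omega> \<T> \<E> (fst s) (snd s))"
    unfolding eq by (rule rep(2))
qed

lemma bilinear_S_form:
  "bilinear_on (trial_space k l) (trial_space k l)
     (\<lambda>s t. S_form \<nu> l \<T> \<E> (fst s) (snd s) (fst t) (snd t))"
  unfolding S_form_def
  by (intro bilinear_on_mult bilinear_on_faces polynomial_operator_mult polynomial_on_const
      polynomial_operator_minus polynomial_operator_fst polynomial_operator_face_proj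
      polynomial_operator_snd_face)

text \<open>Moving the convecting velocity out of the vector products exhibits each term as an integral of two
  factors, one depending on the trial pair and one on the test pair.\<close>

lemma B_form_eq:
  "B_form \<T> \<E> v u uh w \<mu> =
     - (1/3) * cell_inner \<T> (\<lambda>x. v x * u x) (\<lambda>x. \<Sum>i\<in>UNIV. gradient w x $ i)
     + 1/3 * cell_inner \<T> (\<lambda>x. v x * (\<Sum>i\<in>UNIV. gradient u x $ i)) w
     + - (1/3) * bdry_inner \<T> \<E>
        (\<lambda>K F x. (b_vec (trace_from K v x) \<bullet> outward_normal K F) * trace_from K u x) (\<lambda>K F. \<mu>)
     + 1/3 * bdry_inner \<T> \<E>
        (\<lambda>K F x. (b_vec (trace_from K v x) \<bullet> outward_normal K F) * uh x) (\<lambda>K F. trace_from K w)"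
proof -
  have "cell_inner \<T> (\<lambda>x. u x *\<^sub>R b_vec (v x)) (gradient w)
      = cell_inner \<T> (\<lambda>x. v x * u x) (\<lambda>x. \<Sum>i\<in>UNIV. gradient w x $ i)"
    by (simp add: cell_inner_def b_vec_inner mult_ac)
  moreover have "cell_inner \<T> (\<lambda>x. b_vec (v x) \<bullet> gradient u x) w
      = cell_inner \<T> (\<lambda>x. v x * (\<Sum>i\<in>UNIV. gradient u x $ i)) w"
    by (simp only: b_vec_inner)
  ultimately show ?thesis unfolding B_form_def by linarith
qed

lemma bilinear_B_form:
  assumes v: "v \<in> V_space k \<Omega> \<T>"
  shows "bilinear_on (trial_space k l) (trial_space k l)
     (\<lambda>s t. B_form \<T> \<E> v (fst s) (snd s) (fst t) (snd t))"
proof -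
  have v_cell: "polynomial_on K v" if "K \<in> \<T>" for K
    using polynomial_operator_V_space[OF that] v by (auto simp: polynomial_operator_def)
  have v_face: "polynomial_on F (\<lambda>x. b_vec (trace_from K v x) \<bullet> outward_normal K F)"
    if "K \<in> \<T>" "F \<in> faces_of \<E> K" for K F
  proof -
    have "polynomial_on F (trace_from K v)"
      using polynomial_operator_trace_V[OF that] v by (auto simp: polynomial_operator_def)
    then show ?thesis unfolding b_vec_inner by (intro polynomial_on_mult polynomial_on_const)
  qed
  have grad: "polynomial_operator (V_space k \<Omega> \<T>) K (\<lambda>u x. \<Sum>i\<in>UNIV. gradient u x $ i)" if "K \<in> \<T>" for K
    by (intro polynomial_operator_sum polynomial_operator_gradient polynomial_operator_V_space
      cell(1) subspace_V_space that)
  show ?thesis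
    unfolding B_form_eq
    by (intro bilinear_on_plus bilinear_on_mult bilinear_on_cells bilinear_on_faces
        polynomial_operator_mult v_cell v_face polynomial_operator_fst[OF grad]
        polynomial_operator_fst[OF polynomial_operator_V_space]
        polynomial_operator_fst[OF polynomial_operator_trace_V] polynomial_operator_snd_face)
qed

text \<open>For equal trial and test pairs the first two terms have the same integrand with opposite signs,
  and so have the last two. This is the purpose of the skew-symmetrised convective form.\<close>

lemma B_form_skew: "B_form \<T> \<E> v u uh u uh = 0"
  by (simp add: B_form_eq cell_inner_def bdry_inner_def mult_ac)

lemma penalty_nonneg:
  assumes "K \<in> \<T>"
  shows "0 \<le> inverse (mesh_size K) * a * a"
  using mesh_size_pos[OF cell(1-3)[OF assms]] by (simp add: mult.assoc)

lemma S_form_nonneg: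
  assumes "\<nu> > 0"
  shows "S_form \<nu> l \<T> \<E> u uh u uh \<ge> 0"
  unfolding S_form_def bdry_inner_def
  using assms by (intro mult_nonneg_nonneg sum_nonneg integral_nonneg_AE AE_I2 penalty_nonneg) auto

section \<open>The energy identity and unique solvability\<close>

text \<open>The terms of the time step that contain the unknowns; the contribution of the previous iterate
  to the difference quotient belongs to the data.\<close>

definition scheme_form ::
    "real \<Rightarrow> real \<Rightarrow> nat \<Rightarrow> nat \<Rightarrow> (real^'d \<Rightarrow> real) \<Rightarrow>
     (real^'d \<Rightarrow> real) \<times> (real^'d \<Rightarrow> real) \<Rightarrow> (real^'d \<Rightarrow> real) \<times> (real^'d \<Rightarrow> real) \<Rightarrow> real" where
  "scheme_form \<Delta>t \<nu> k l v s t =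
     1 / \<Delta>t * cell_inner \<T> (fst s) (fst t)
     + \<nu> * cell_inner \<T> (K_op k \<Omega> \<T> \<E> (fst s) (snd s)) (K_op k \<Omega> \<T> \<E> (fst t) (snd t))
     + S_form \<nu> l \<T> \<E> (fst s) (snd s) (fst t) (snd t)
     + B_form \<T> \<E> v (fst s) (snd s) (fst t) (snd t)"

lemma bilinear_scheme_form:
  assumes "v \<in> V_space k \<Omega> \<T>"
  shows "bilinear_on (trial_space k l) (trial_space k l) (scheme_form \<Delta>t \<nu> k l v)"
  unfolding scheme_form_def[abs_def]
proof (intro bilinear_on_plus bilinear_on_mult bilinear_S_form bilinear_B_form assms)
  show "bilinear_on (trial_space k l) (trial_space k l) (\<lambda>s t. cell_inner \<T> (fst s) (fst t))"
    by (rule bilinear_on_compose[OF bilinear_V linear_on_fst _ linear_on_fst]) (auto simp: trial_space_def)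
  show "bilinear_on (trial_space k l) (trial_space k l)
     (\<lambda>s t. cell_inner \<T> (K_op k \<Omega> \<T> \<E> (fst s) (snd s)) (K_op k \<Omega> \<T> \<E> (fst t) (snd t)))"
    by (rule bilinear_on_compose[OF bilinear_Q K_op(2) _ K_op(2)]) (auto intro: K_op(1))
qed

text \<open>With \<open>u = 0\<close> the penalty is a sum of weighted squared norms of \<open>uh\<close> over the faces of all
  cells.\<close>

lemma S_form_definite:
  assumes "\<nu> > 0" and uh: "uh \<in> Vhat_space l \<Omega> \<E>" and 0: "S_form \<nu> l \<T> \<E> 0 uh 0 uh = 0"
  shows "uh = 0"
proof -
  have "uh x = 0" if F: "F \<in> \<E>" and x: "x \<in> F" for F x
  proof -
    obtain K where K: "K \<in> \<T>" "F \<in> faces_of \<E> K" using face_has_cell[OF F] by blast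
    have "face_proj l F (trace_from K 0) x = 0" if "x \<in> F" for x
    proof -
      \<comment> \<open>Only the zero function matters here, so any polynomial degree of the space serves.\<close>
      have "linear_on_set (V_space 0 \<Omega> \<T>) (\<lambda>u. face_proj l F (trace_from K u) x)"
        using polynomial_operator_face_proj[OF K] that by (simp add: polynomial_operator_def)
      then show ?thesis by (rule linear_on_set_0) (rule subspace_0[OF subspace_V_space])
    qed
    then have g: "(\<integral>x. inverse (mesh_size K) * (face_proj l F (trace_from K 0) x - uh x) *
          (face_proj l F (trace_from K 0) x - uh x) \<partial>surface_measure F)
        = inverse (mesh_size K) * (\<integral>x. uh x * uh x \<partial>surface_measure F)"
      unfolding Bochner_Integration.integral_mult_right_zero[symmetric]
      by (intro Bochner_Integration.integral_cong) (auto simp: face(2)[OF F])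
    have h: "mesh_size K > 0" by (rule mesh_size_pos[OF cell(1-3)[OF K(1)]])
    have nonneg: "0 \<le> (\<integral>x. inverse (mesh_size L) * (face_proj l G (trace_from L 0) x - uh x) *
          (face_proj l G (trace_from L 0) x - uh x) \<partial>surface_measure G)" if "L \<in> \<T>" for L G
      using that by (intro integral_nonneg_AE AE_I2 penalty_nonneg)
    have "(\<Sum>L\<in>\<T>. \<Sum>G\<in>faces_of \<E> L. \<integral>x. inverse (mesh_size L) *
          (face_proj l G (trace_from L 0) x - uh x) *
          (face_proj l G (trace_from L 0) x - uh x) \<partial>surface_measure G) = 0"
      using 0 assms(1) by (simp add: S_form_def bdry_inner_def)
    then have "(\<Sum>G\<in>faces_of \<E> K. \<integral>x. inverse (mesh_size K) *
          (face_proj l G (trace_from K 0) x - uh x) *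
          (face_proj l G (trace_from K 0) x - uh x) \<partial>surface_measure G) = 0"
      by (subst (asm) sum_nonneg_eq_0_iff) (auto intro: sum_nonneg nonneg finite_cells K(1))
    then have "(\<integral>x. inverse (mesh_size K) *
          (face_proj l F (trace_from K 0) x - uh x) *
          (face_proj l F (trace_from K 0) x - uh x) \<partial>surface_measure F) = 0"
      by (subst (asm) sum_nonneg_eq_0_iff) (auto intro: nonneg finite_faces_of K)
    then have "(\<integral>x. uh x * uh x \<partial>surface_measure F) = 0" using g h by simp
    moreover have "polynomial_on F uh"
      using polynomial_operator_Vhat_space[OF F] uh by (auto simp: polynomial_operator_def)
    ultimately show ?thesis
      using bounded_full_measure.polynomial_eq_0[OF face(1)[OF F], of uh x] x by (simp add: face(2)[OF F])
  qed
  moreover have "zero_ext (\<Union>\<E>) uh = uh" using uh by (simp add: Vhat_space_def)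
  ultimately show ?thesis by (metis UnionE ext zero_ext_def zero_fun_apply)
qed

lemma scheme_form_pos:
  assumes "\<Delta>t > 0" "\<nu> > 0" and s: "s \<in> trial_space k l" "s \<noteq> 0"
  shows "scheme_form \<Delta>t \<nu> k l v s s > 0"
proof -
  obtain u uh where s_eq: "s = (u, uh)" by (cases s)
  have u: "u \<in> V_space k \<Omega> \<T>" and uh: "uh \<in> Vhat_space l \<Omega> \<E>"
    using s(1) by (auto simp: trial_space_def s_eq)
  let ?q = "K_op k \<Omega> \<T> \<E> u uh"
  have form: "scheme_form \<Delta>t \<nu> k l v s s =
      1 / \<Delta>t * cell_inner \<T> u u + \<nu> * cell_inner \<T> ?q ?q + S_form \<nu> l \<T> \<E> u uh u uh"
    by (simp add: scheme_form_def s_eq B_form_skew)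
  have nonneg: "1 / \<Delta>t * cell_inner \<T> u u \<ge> 0" "\<nu> * cell_inner \<T> ?q ?q \<ge> 0"
    "S_form \<nu> l \<T> \<E> u uh u uh \<ge> 0"
    using assms(1,2) by (simp_all add: cell_inner_nonneg S_form_nonneg)
  have "scheme_form \<Delta>t \<nu> k l v s s \<noteq> 0"
  proof
    assume "scheme_form \<Delta>t \<nu> k l v s s = 0"
    then have "1 / \<Delta>t * cell_inner \<T> u u = 0" and S: "S_form \<nu> l \<T> \<E> u uh u uh = 0"
      using nonneg unfolding form by linarith+
    then have "u = 0" using cell_inner_definite_V[OF u] assms(1) by simp
    with S have "uh = 0" using S_form_definite[OF assms(2) uh] by simp
    with \<open>u = 0\<close> show False using s(2) by (simp add: s_eq zero_prod_def)
  qed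
  then show ?thesis using nonneg unfolding form by linarith
qed

text \<open>The source is merely square integrable, so its products with test functions are integrable by
  the bound of a product by the sum of the squares.\<close>

lemma linear_load:
  assumes "open \<Omega>" "g \<in> L2 (lebesgue_on \<Omega>)"
  shows "linear_on_set (V_space k \<Omega> \<T>) (cell_inner \<T> g)"
proof -
  have int: "integrable (lebesgue_on K) (\<lambda>x. g x * w x)" if "w \<in> V_space k \<Omega> \<T>" "K \<in> \<T>" for w K
  proof (rule integrable_L2_mult)
    have "w \<in> L2 (lebesgue_on \<Omega>)" using that(1) by (simp add: V_space_def)
    then show "w \<in> L2 (lebesgue_on K)" by (rule L2_restrict) (use cell(1,4) that(2) assms(1) in auto)
    show "g \<in> L2 (lebesgue_on K)" by (rule L2_restrict[OF assms(2)]) (use cell(1,4) that(2) assms(1) in auto)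
  qed
  then show ?thesis
    unfolding cell_inner_def inner_real_def
    by (intro linear_on_set_sum linear_on_setI) (simp_all add: algebra_simps)
qed

end

theorem theorem4p2:
  fixes \<Omega> :: "(real^'d) set"
    and \<T> \<E> :: "(real^'d) set set"
    and \<theta> l\<^sub>s \<nu> Tend \<Delta>t :: real
    and k l N n :: nat
    and f :: "real \<Rightarrow> real^'d \<Rightarrow> real"
    and u\<^sub>p :: "real^'d \<Rightarrow> real"
  assumes "CARD('d) = 2 \<or> CARD('d) = 3"
    and "open \<Omega>" and "polyhedral \<Omega>"
    and "polytopal_mesh \<Omega> \<T> \<E>"
    and "\<theta> > 0" and "l\<^sub>s > 0" and "shape_regular \<theta> l\<^sub>s \<T> \<E>"
    and "k \<ge> 1" and "l \<in> {k - 1, k}"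
    and "\<nu> > 0" and "Tend > 0" and "N \<ge> 1" and "\<Delta>t = Tend / real N"
    and "1 \<le> n" and "n \<le> N"
    and "f (real n * \<Delta>t) \<in> L2 (lebesgue_on \<Omega>)"
    and "u\<^sub>p \<in> V_space k \<Omega> \<T>"
  shows "\<exists>!s. case s of (q, u, uh) \<Rightarrow>
     q \<in> Q_space k \<Omega> \<T> \<and> u \<in> V_space k \<Omega> \<T> \<and> uh \<in> Vhat_space l \<Omega> \<E> \<and>
     (\<forall>x. q x + K_op k \<Omega> \<T> \<E> u uh x = 0) \<and>
     (\<forall>w\<in>V_space k \<Omega> \<T>. \<forall>\<mu>\<in>Vhat_space l \<Omega> \<E>.
        cell_inner \<T> (\<lambda>x. (u x - u\<^sub>p x) / \<Delta>t) w
        + \<nu> * cell_inner \<T> (K_op k \<Omega> \<T> \<E> u uh) (K_op k \<Omega> \<T> \<E> w \<mu>)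
        + S_form \<nu> l \<T> \<E> u uh w \<mu>
        + B_form \<T> \<E> u\<^sub>p u uh w \<mu>
        = cell_inner \<T> (f (real n * \<Delta>t)) w)"
proof -
  interpret mesh \<Omega> \<T> \<E> by standard (fact assms(4))
  let ?W = "trial_space k l" and ?a = "scheme_form \<Delta>t \<nu> k l u\<^sub>p"
  define L where "L t = cell_inner \<T> (f (real n * \<Delta>t)) (fst t) + 1 / \<Delta>t * cell_inner \<T> u\<^sub>p (fst t)"
    for t :: "(real^'d \<Rightarrow> real) \<times> (real^'d \<Rightarrow> real)"
  have up_L2: "u\<^sub>p \<in> L2 (lebesgue_on \<Omega>)" using assms(17) by (simp add: V_space_def)
  have lin_fst: "linear_on_set ?W (\<lambda>t. M (fst t))"
    if "linear_on_set (V_space k \<Omega> \<T>) M" for M :: "(real^'d \<Rightarrow> real) \<Rightarrow> real"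
    using that by (auto simp: linear_on_set_def trial_space_def)
  have "linear_on_set ?W L"
    unfolding L_def[abs_def]
    by (intro linear_on_set_plus linear_on_set_mult lin_fst linear_load assms(2,16) up_L2)
  then have ex: "\<exists>!s. s \<in> ?W \<and> (\<forall>t\<in>?W. ?a s t = L t)"
    using assms(10-13,17)
    by (intro galerkin_unique_solution subspace_trial_space finite_dim_trial_space
      bilinear_scheme_form scheme_form_pos) auto
  have increment: "cell_inner \<T> (\<lambda>x. (u x - u\<^sub>p x) / \<Delta>t) w
      = 1 / \<Delta>t * cell_inner \<T> u w - 1 / \<Delta>t * cell_inner \<T> u\<^sub>p w"
    if "u \<in> V_space k \<Omega> \<T>" "w \<in> V_space k \<Omega> \<T>" for u w
  proof -
    have lin: "linear_on_set (V_space k \<Omega> \<T>) (\<lambda>u. cell_inner \<T> u w)"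
      using bilinear_V that(2) by (simp add: bilinear_on_def)
    have "(\<lambda>x. (u x - u\<^sub>p x) / \<Delta>t) = (1 / \<Delta>t) *\<^sub>R (u - u\<^sub>p)" by (simp add: fun_eq_iff)
    moreover have "u - u\<^sub>p \<in> V_space k \<Omega> \<T>" by (intro subspace_diff[OF subspace_V_space] that(1) assms(17))
    ultimately show ?thesis
      using linear_on_set_scale[OF lin] linear_on_set_diff[OF lin subspace_V_space that(1) assms(17)]
      by (simp add: right_diff_distrib)
  qed
  have weak: "(\<forall>w\<in>V_space k \<Omega> \<T>. \<forall>\<mu>\<in>Vhat_space l \<Omega> \<E>.
        cell_inner \<T> (\<lambda>x. (u x - u\<^sub>p x) / \<Delta>t) w
        + \<nu> * cell_inner \<T> (K_op k \<Omega> \<T> \<E> u uh) (K_op k \<Omega> \<T> \<E> w \<mu>)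
        + S_form \<nu> l \<T> \<E> u uh w \<mu> + B_form \<T> \<E> u\<^sub>p u uh w \<mu>
        = cell_inner \<T> (f (real n * \<Delta>t)) w) \<longleftrightarrow> (\<forall>t\<in>?W. ?a (u, uh) t = L t)"
    if "u \<in> V_space k \<Omega> \<T>" for u uh
  proof -
    have "(cell_inner \<T> (\<lambda>x. (u x - u\<^sub>p x) / \<Delta>t) w
        + \<nu> * cell_inner \<T> (K_op k \<Omega> \<T> \<E> u uh) (K_op k \<Omega> \<T> \<E> w \<mu>)
        + S_form \<nu> l \<T> \<E> u uh w \<mu> + B_form \<T> \<E> u\<^sub>p u uh w \<mu>
        = cell_inner \<T> (f (real n * \<Delta>t)) w) \<longleftrightarrow> ?a (u, uh) (w, \<mu>) = L (w, \<mu>)"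
      if "w \<in> V_space k \<Omega> \<T>" for w \<mu>
      unfolding scheme_form_def L_def increment[OF \<open>u \<in> V_space k \<Omega> \<T>\<close> that] fst_conv snd_conv by linarith
    then show ?thesis by (auto simp: trial_space_def)
  qed
  have gradient: "(\<forall>x. q x + K_op k \<Omega> \<T> \<E> u uh x = 0) \<longleftrightarrow> q = - K_op k \<Omega> \<T> \<E> u uh" for q u uh
    by (auto simp: fun_eq_iff add_eq_0_iff2)
  obtain u uh where s: "(u, uh) \<in> ?W" "\<forall>t\<in>?W. ?a (u, uh) t = L t"
    and unique: "\<And>u' uh'. (u', uh') \<in> ?W \<Longrightarrow> \<forall>t\<in>?W. ?a (u', uh') t = L t \<Longrightarrow> u' = u \<and> uh' = uh"
    using ex by (smt (verit) Pair_inject prod.exhaust)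
  have Q: "- K_op k \<Omega> \<T> \<E> u uh \<in> Q_space k \<Omega> \<T>"
    using K_op(1)[OF s(1)] subspace_neg[OF subspace_Q_space] by simp
  show ?thesis
  proof (rule ex1I[of _ "(- K_op k \<Omega> \<T> \<E> u uh, u, uh)"], goal_cases)
    case 1
    have "u \<in> V_space k \<Omega> \<T>" "uh \<in> Vhat_space l \<Omega> \<E>" using s(1) by (auto simp: trial_space_def)
    then show ?case using Q s(2) by (simp only: prod.case gradient weak)
  next
    case (2 s')
    obtain q' u' uh' where s': "s' = (q', u', uh')" by (cases s')
    have u': "u' \<in> V_space k \<Omega> \<T>" "uh' \<in> Vhat_space l \<Omega> \<E>" using 2 by (auto simp: s')
    then have "\<forall>t\<in>?W. ?a (u', uh') t = L t" and q': "q' = - K_op k \<Omega> \<T> \<E> u' uh'"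
      using 2 unfolding s' prod.case gradient weak[OF u'(1)] by blast+
    then have "u' = u \<and> uh' = uh" using unique u' by (simp add: trial_space_def)
    then show ?case using q' by (simp add: s')
  qed
qed

end
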